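(* Assume that problems (P) and (D) are both feasible. Let $\{\delta_k\}_{k=0}^\infty$ be a sequence with $\delta_k\ge 0$ and $\sum_{k=0}^\infty\delta_k<\infty$, let $r>\sum_{k=0}^{\infty}\delta_k$, and let $\kappa>0$ be a constant associated with $r$ such that $$\mathrm{dist}\big((x,y,z),T_\ell^{-1}(0)\big)\le\kappa\,\mathrm{dist}\big(0,T_\ell(x,y,z)\big)$$ for all $(x,y,z)\in\mathbb{R}^{2n+m}$ with $\mathrm{dist}\big((x,y,z),T_\ell^{-1}(0)\big)\le r$. Let $\{(x_k,y_k,z_k)\}_{k=0}^\infty$ be generated by Algorithm PD-PMM, where $(x_0,y_0,z_0)$ is chosen to satisfy $$\mathrm{dist}_{R_0}\big((x_0,y_0,z_0),T_\ell^{-1}(0)\big)\le r-\sum_{k=0}^\infty\delta_k,$$ and where the sequence of tolerances $\{\epsilon_k\}_{k=0}^\infty$ is chosen such that $$\epsilon_k\le\frac{\min\{\sqrt{\tau_k},1\}}{\beta_k}\min\big\{\delta_k,\ \delta_k'\,\|(x_{k+1},y_{k+1},z_{k+1})-(x_k,y_k,z_k)\|_{R_k}\big\},$$ with $0\le\delta_k'<1$ and $\sum_{k=0}^\infty\delta_k'<\infty$. Then, for all $k\ge0$, $$\mathrm{dist}_{R_{k+1}}\big((x_{k+1},y_{k+1},z_{k+1}),T_\ell^{-1}(0)\big)\le\mu_k\,\mathrm{dist}_{R_k}\big((x_k,y_k,z_k),T_\ell^{-1}(0)\big),$$ where $$\mu_k:=(1-\delta_k')^{-1}\left(\delta_k'+(1+\delta_k')\frac{\kappa\gamma_k}{\sqrt{\beta_k^2+\kappa^2\gamma_k^2}}\right),\qquad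 \lim_{k\to\infty}\mu_k=\mu_\infty:=\frac{\kappa\gamma_\infty}{\sqrt{\beta_\infty^2+\kappa^2\gamma_\infty^2}},$$ with $\gamma_k:=\max\{\tau_k,1\}$ and $\gamma_\infty:=\max\{\tau_\infty,1\}$ (and $\mu_\infty=0$ if $\beta_\infty=\infty$).
   Context: Problem data: $c \in \mathbb{R}^n$, $Q \in \mathbb{R}^{n\times n}$ symmetric positive semidefinite, $A \in \mathbb{R}^{m\times n}$ with $m \le n$, $b\in\mathbb{R}^m$, $g(x)=\|Dx\|_1$ with $D\in\mathbb{R}^{n\times n}$ diagonal and positive semidefinite, and $\mathcal{K}=\{x\in\mathbb{R}^n : a_l\le x\le a_u\}$ where $a_l\le a_u$ are vectors whose entries may be infinite (i.e. bounds may be absent). $\delta_{\mathcal{K}}$ is the indicator function of $\mathcal{K}$ ($0$ on $\mathcal K$, $+\infty$ elsewhere), $^*$ on a function denotes the Fenchel conjugate, $\Pi_{\mathcal{C}}$ is the Euclidean projection onto a closed convex set $\mathcal{C}$, $\|\cdot\|$ is the Euclidean norm, $\partial$ is the convex subdifferential. For a symmetric positive definite matrix $R$, $\|p\|_R^2=p^\top Rp$ and $\mathrm{dist}_R(p,\mathcal{C})=\inf_{p'\in\mathcal{C}}\|p-p'\|_R$; $\mathrm{dist}=\mathrm{dist}_I$. Primal problem (P): $\min_{x\in\mathbb{R}^n}\ c^\top x+\frac12 x^\top Qx+g(x)+\delta_{\mathcal{K}}(x)$ subject to $Ax=b$. Dual problem (D): $\max_{x\in\mathbb{R}^n,\,y\in\mathbb{R}^m,\,z\in\mathbb{R}^n}\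 b^\top y-\frac12 x^\top Qx-\delta_{\mathcal{K}}^*(z)-g^*(A^\top y-c-Qx-z)$. Feasible means that there is a point satisfying the constraints at which the objective is finite. Algorithm PD-PMM (primal-dual proximal method of multipliers). Input: $(x_0,y_0,z_0)\in\mathbb{R}^n\times\mathbb{R}^m\times\mathbb{R}^n$; a sequence $\{\tau_k\}_{k\ge0}$ of positive numbers that is non-increasing with limit $\tau_\infty>0$; a non-decreasing sequence $\{\beta_k\}_{k\ge 0}$ with $\beta_0>0$ and $\beta_k\nearrow\beta_\infty\le\infty$; $\rho_k=\beta_k/\tau_k$; and positive tolerances $\epsilon_k\to0$. For $k=0,1,2,\dots$: find $(x_{k+1},y_{k+1})$ such that $$\mathrm{dist}\big(0,F_{\beta_k,\rho_k}(x_{k+1},y_{k+1})\big)\le\epsilon_k,$$ and set $z_{k+1}=(z_k+\beta_kx_{k+1})-\beta_k\Pi_{\mathcal{K}}(\beta_k^{-1}z_k+x_{k+1})$. Here $$r_{\beta_k,\rho_k}(x,y)=c+Qx-A^\top y+(z_k+\beta_kx)-\beta_k\Pi_{\mathcal{K}}(\beta_k^{-1}z_k+x)+\rho_k^{-1}(x-x_k),$$ $$F_{\beta_k,\rho_k}(x,y)=\big\{(u',v')\in\mathbb{R}^n\times\mathbb{R}^m:\ u'\in r_{\beta_k,\rho_k}(x,y)+\partial g(x),\ v'=Ax+\beta_k^{-1}(y-y_k)-b\big\}.$$ The maximal monotone operator $T_\ell:\mathbb{R}^{2n+m}\rightrightarrows\mathbb{R}^{2n+m}$ associated with (P)--(D)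 is $$T_\ell(x,y,z)=\big\{(u',v',w')\in\mathbb{R}^n\times\mathbb{R}^m\times\mathbb{R}^n:\ u'\in Qx+c-A^\top y+z+\partial g(x),\ v'=Ax-b,\ w'+x\in\partial\delta_{\mathcal{K}}^*(z)\big\},$$ and $T_\ell^{-1}(0)=\{(x,y,z): 0\in T_\ell(x,y,z)\}$. The matrices $R_k$ are $R_k=\tau_kI_n\oplus I_m\oplus I_n$ (block-diagonal), acting on $(x,y,z)\in\mathbb{R}^n\times\mathbb{R}^m\times\mathbb{R}^n$. For every $r>0$ a constant $\kappa>0$ with the stated error-bound property exists, since $T_\ell$ is a polyhedral multifunction. *)

theory Defs
  imports "HOL-Analysis.Analysis"
begin

(* The spaces R^(n+m) and R^(2n+m) are the product types
   (real^'n) * (real^'m) and (real^'n) * (real^'m) * (real^'n); their library inner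
   product and norm are the Euclidean ones.
   Extended-real-valued functions have type 'a => ereal. *)

definition indicator_fun :: "'a set \<Rightarrow> 'a \<Rightarrow> ereal" where
  "indicator_fun C x = (if x \<in> C then 0 else \<infinity>)"

definition fenchel_conjugate :: "('a::real_inner \<Rightarrow> ereal) \<Rightarrow> 'a \<Rightarrow> ereal" where
  "fenchel_conjugate f v = (SUP x. ereal (v \<bullet> x) - f x)"

definition subdifferential :: "('a::real_inner \<Rightarrow> ereal) \<Rightarrow> 'a \<Rightarrow> 'a set" where
  "subdifferential f x = {v. \<forall>y. f x + ereal (v \<bullet> (y - x)) \<le> f y}"

(* A matrix R on a product space is given by the linear map p |-> R p. *)
definition norm_wrt :: "('a::real_inner \<Rightarrow> 'a) \<Rightarrow> 'a \<Rightarrow> real" where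
  "norm_wrt R p = sqrt (p \<bullet> R p)"

(* Extended-real-valued, so that the distance to the empty set is infinity
   (the library's infdist would give 0 there, e.g. where T_ell takes an empty value). *)
definition dist_wrt :: "('a::real_inner \<Rightarrow> 'a) \<Rightarrow> 'a \<Rightarrow> 'a set \<Rightarrow> ereal" where
  "dist_wrt R p C = (INF p'\<in>C. ereal (norm_wrt R (p - p')))"

abbreviation dist_set :: "'a::real_inner \<Rightarrow> 'a set \<Rightarrow> ereal" where
  "dist_set \<equiv> dist_wrt id"

definition pos_semidef :: "real^'n^'n \<Rightarrow> bool" where
  "pos_semidef M \<longleftrightarrow> transpose M = M \<and> (\<forall>x. 0 \<le> x \<bullet> (M *v x))"

definition diagonal :: "real^'n^'n \<Rightarrow> bool" where
  "diagonal M \<longleftrightarrow> (\<forall>i j. i \<noteq> j \<longrightarrow> M $ i $ j = 0)"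

definition norm1 :: "real^'n \<Rightarrow> real" where
  "norm1 v = (\<Sum>i\<in>UNIV. \<bar>v $ i\<bar>)"

definition g_fun :: "real^'n^'n \<Rightarrow> real^'n \<Rightarrow> ereal" where
  "g_fun D x = ereal (norm1 (D *v x))"

definition box_set :: "ereal^'n \<Rightarrow> ereal^'n \<Rightarrow> (real^'n) set" where
  "box_set al au = {x. \<forall>i. al $ i \<le> ereal (x $ i) \<and> ereal (x $ i) \<le> au $ i}"

definition primal_objective ::
  "real^'n \<Rightarrow> real^'n^'n \<Rightarrow> real^'n^'n \<Rightarrow> (real^'n) set \<Rightarrow> real^'n \<Rightarrow> ereal" where
  "primal_objective c Q D K x =
     ereal (c \<bullet> x + (1/2) * (x \<bullet> (Q *v x))) + g_fun D x + indicator_fun K x"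

definition primal_feasible ::
  "real^'n \<Rightarrow> real^'n^'n \<Rightarrow> real^'n^'m \<Rightarrow> real^'m \<Rightarrow> real^'n^'n \<Rightarrow> (real^'n) set \<Rightarrow> bool" where
  "primal_feasible c Q A b D K \<longleftrightarrow>
     (\<exists>x. A *v x = b \<and> \<bar>primal_objective c Q D K x\<bar> \<noteq> \<infinity>)"

definition dual_objective ::
  "real^'n \<Rightarrow> real^'n^'n \<Rightarrow> real^'n^'m \<Rightarrow> real^'m \<Rightarrow> real^'n^'n \<Rightarrow> (real^'n) set
    \<Rightarrow> real^'n \<Rightarrow> real^'m \<Rightarrow> real^'n \<Rightarrow> ereal" where
  "dual_objective c Q A b D K x y z =
     ereal (b \<bullet> y - (1/2) * (x \<bullet> (Q *v x)))
       - fenchel_conjugate (indicator_fun K) z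
       - fenchel_conjugate (g_fun D) (transpose A *v y - c - Q *v x - z)"

definition dual_feasible ::
  "real^'n \<Rightarrow> real^'n^'n \<Rightarrow> real^'n^'m \<Rightarrow> real^'m \<Rightarrow> real^'n^'n \<Rightarrow> (real^'n) set \<Rightarrow> bool" where
  "dual_feasible c Q A b D K \<longleftrightarrow>
     (\<exists>x y z. \<bar>dual_objective c Q A b D K x y z\<bar> \<noteq> \<infinity>)"

definition T_ell ::
  "real^'n \<Rightarrow> real^'n^'n \<Rightarrow> real^'n^'m \<Rightarrow> real^'m \<Rightarrow> real^'n^'n \<Rightarrow> (real^'n) set
    \<Rightarrow> (real^'n) \<times> (real^'m) \<times> (real^'n) \<Rightarrow> ((real^'n) \<times> (real^'m) \<times> (real^'n)) set" where
  "T_ell c Q A b D K = (\<lambda>(x, y, z). {(u', v', w').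
     u' \<in> (\<lambda>s. Q *v x + c - transpose A *v y + z + s) ` subdifferential (g_fun D) x \<and>
     v' = A *v x - b \<and>
     w' + x \<in> subdifferential (fenchel_conjugate (indicator_fun K)) z})"

definition T_ell_zeros ::
  "real^'n \<Rightarrow> real^'n^'n \<Rightarrow> real^'n^'m \<Rightarrow> real^'m \<Rightarrow> real^'n^'n \<Rightarrow> (real^'n) set
    \<Rightarrow> ((real^'n) \<times> (real^'m) \<times> (real^'n)) set" where
  "T_ell_zeros c Q A b D K = {p. 0 \<in> T_ell c Q A b D K p}"

definition R_op ::
  "real \<Rightarrow> (real^'n) \<times> (real^'m) \<times> (real^'n) \<Rightarrow> (real^'n) \<times> (real^'m) \<times> (real^'n)" where
  "R_op \<tau> = (\<lambda>(x, y, z). (\<tau> *\<^sub>R x, y, z))"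

(* closest_point K is the Euclidean projection onto the closed convex set K. *)
definition multiplier_update ::
  "(real^'n) set \<Rightarrow> real \<Rightarrow> real^'n \<Rightarrow> real^'n \<Rightarrow> real^'n" where
  "multiplier_update K \<beta> zk x =
     (zk + \<beta> *\<^sub>R x) - \<beta> *\<^sub>R closest_point K ((1/\<beta>) *\<^sub>R zk + x)"

definition r_map ::
  "real^'n \<Rightarrow> real^'n^'n \<Rightarrow> real^'n^'m \<Rightarrow> (real^'n) set \<Rightarrow> real \<Rightarrow> real
    \<Rightarrow> real^'n \<Rightarrow> real^'n \<Rightarrow> real^'n \<Rightarrow> real^'m \<Rightarrow> real^'n" where
  "r_map c Q A K \<beta> \<rho> xk zk x y =
     c + Q *v x - transpose A *v y + multiplier_update K \<beta> zk x + (1/\<rho>) *\<^sub>R (x - xk)"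

definition F_map ::
  "real^'n \<Rightarrow> real^'n^'n \<Rightarrow> real^'n^'m \<Rightarrow> real^'m \<Rightarrow> real^'n^'n \<Rightarrow> (real^'n) set \<Rightarrow> real \<Rightarrow> real
    \<Rightarrow> real^'n \<Rightarrow> real^'m \<Rightarrow> real^'n \<Rightarrow> real^'n \<Rightarrow> real^'m \<Rightarrow> ((real^'n) \<times> (real^'m)) set" where
  "F_map c Q A b D K \<beta> \<rho> xk yk zk x y = {(u', v').
     u' \<in> (\<lambda>s. r_map c Q A K \<beta> \<rho> xk zk x y + s) ` subdifferential (g_fun D) x \<and>
     v' = A *v x + (1/\<beta>) *\<^sub>R (y - yk) - b}"

definition pd_pmm_iterates ::
  "real^'n \<Rightarrow> real^'n^'n \<Rightarrow> real^'n^'m \<Rightarrow> real^'m \<Rightarrow> real^'n^'n \<Rightarrow> (real^'n) set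
    \<Rightarrow> (nat \<Rightarrow> real) \<Rightarrow> (nat \<Rightarrow> real) \<Rightarrow> (nat \<Rightarrow> real)
    \<Rightarrow> (nat \<Rightarrow> real^'n) \<Rightarrow> (nat \<Rightarrow> real^'m) \<Rightarrow> (nat \<Rightarrow> real^'n) \<Rightarrow> bool" where
  "pd_pmm_iterates c Q A b D K \<tau> \<beta> \<epsilon> x y z \<longleftrightarrow> (\<forall>k.
     dist_set 0 (F_map c Q A b D K (\<beta> k) (\<beta> k / \<tau> k) (x k) (y k) (z k) (x (Suc k)) (y (Suc k)))
       \<le> ereal (\<epsilon> k) \<and>
     z (Suc k) = multiplier_update K (\<beta> k) (z k) (x (Suc k)))"

definition \<gamma>_of :: "real \<Rightarrow> real" where
  "\<gamma>_of \<tau> = max \<tau> 1"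

definition \<mu>_rate :: "real \<Rightarrow> real \<Rightarrow> real \<Rightarrow> real \<Rightarrow> real" where
  "\<mu>_rate \<kappa> \<tau> \<beta> \<delta>' =
     inverse (1 - \<delta>') *
       (\<delta>' + (1 + \<delta>') * (\<kappa> * \<gamma>_of \<tau> / sqrt (\<beta>\<^sup>2 + \<kappa>\<^sup>2 * (\<gamma>_of \<tau>)\<^sup>2)))"

definition \<mu>_limit :: "real \<Rightarrow> real \<Rightarrow> ereal \<Rightarrow> real" where
  "\<mu>_limit \<kappa> \<tau>_lim \<beta>_lim =
     (if \<beta>_lim = \<infinity> then 0
      else \<kappa> * \<gamma>_of \<tau>_lim / sqrt ((real_of_ereal \<beta>_lim)\<^sup>2 + \<kappa>\<^sup>2 * (\<gamma>_of \<tau>_lim)\<^sup>2))"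

end

theory Submission
  imports Defs
begin

text \<open>The iteration is an inexact proximal point method for \<open>T_ell\<close> in the metric of \<open>R_op (\<tau> k)\<close>.
  The exact step \<open>P\<close> from \<open>p\<close> satisfies \<open>\<parallel>P - s\<parallel>\<^sup>2 + \<parallel>p - P\<parallel>\<^sup>2 \<le> \<parallel>p - s\<parallel>\<^sup>2\<close> for every zero \<open>s\<close>, and the
  residual at \<open>P\<close> is at most a multiple of \<open>\<parallel>p - P\<parallel>\<close>, so the error bound turns the dropped term into a
  contraction; the tolerances control the distance of the computed iterate to \<open>P\<close>. For \<open>\<tau> k < 1\<close>
  the Euclidean distance of \<open>P\<close> to the zeros may exceed \<open>r\<close> although the weighted one does not;
  the residual is then still at least \<open>r / \<kappa>\<close>, which is all that the contraction needs.\<close>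

section \<open>Weighted distances as real-valued infima\<close>

lemma le_infdist:
  assumes "S \<noteq> {}" "\<And>s. s \<in> S \<Longrightarrow> c \<le> dist p s"
  shows "c \<le> infdist p S"
  using assms by (auto simp: infdist_notempty intro: cINF_greatest)

text \<open>With \<open>L\<close> a square root of \<open>R\<close>, the weighted distance is a
  Euclidean distance between images under \<open>L\<close>, so the theory of \<open>infdist\<close>
  applies. Nonemptiness excludes the value infinity.\<close>

lemma dist_wrt_eq_infdist:
  assumes "linear L" "\<And>p. norm_wrt R p = norm (L p)" "S \<noteq> {}"
  shows "dist_wrt R p S = ereal (infdist (L p) (L ` S))"
proof -
  have "infdist (L p) (L ` S) = Inf ((\<lambda>s. norm_wrt R (p - s)) ` S)"
    using assms by (simp add: infdist_notempty image_image dist_norm linear_diff)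
  also have "ereal \<dots> = (INF a\<in>(\<lambda>s. norm_wrt R (p - s)) ` S. ereal a)"
    using assms by (intro ereal_Inf') (auto intro!: bdd_belowI[where m = 0])
  finally show ?thesis
    by (simp add: dist_wrt_def image_image)
qed

lemma norm_wrt_id: "norm_wrt id p = norm p"
  by (simp add: norm_wrt_def norm_eq_sqrt_inner)

lemma dist_set_eq_infdist: "S \<noteq> {} \<Longrightarrow> dist_set p S = ereal (infdist p S)"
  using dist_wrt_eq_infdist[of id id S p] by (simp add: norm_wrt_id linear_id)

section \<open>Maximal monotone operators and the weighted proximal step\<close>

text \<open>Maximality enters in Minty's form: the resolvent is defined on the whole space for every
  step length \<open>t\<close>.\<close>

locale maximal_monotone =
  fixes T :: "'a::euclidean_space \<Rightarrow> 'a set"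
  assumes monotone: "u \<in> T p \<Longrightarrow> v \<in> T q \<Longrightarrow> 0 \<le> (u - v) \<bullet> (p - q)"
    and resolvent: "0 < t \<Longrightarrow> \<exists>q. (1 / t) *\<^sub>R (p - q) \<in> T q"
begin

definition zeros :: "'a set" where
  "zeros = {p. 0 \<in> T p}"

text \<open>Testing monotonicity against the resolvent point \<open>P\<close> of the limit
  \<open>l\<close> leaves minus the squared norm of \<open>l - P\<close>, which forces
  \<open>l = P\<close>.\<close>

lemma zeros_limit:
  assumes "\<And>n. v n \<in> T (q n)" "q \<longlonglongrightarrow> l" "v \<longlonglongrightarrow> 0"
  shows "l \<in> zeros"
proof -
  obtain P where P: "l - P \<in> T P"
    using resolvent[of 1 l] by auto
  have "(\<lambda>n. (v n - (l - P)) \<bullet> (q n - P)) \<longlonglongrightarrow> (0 - (l - P)) \<bullet> (l - P)"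
    by (intro tendsto_intros assms)
  then have "0 \<le> (0 - (l - P)) \<bullet> (l - P)"
    by (rule LIMSEQ_le_const) (auto intro!: monotone assms P)
  then have "(l - P) \<bullet> (l - P) \<le> 0"
    by (simp add: inner_diff_left)
  then have "l = P"
    by (metis antisym inner_eq_zero_iff inner_ge_zero right_minus_eq)
  with P show ?thesis
    by (simp add: zeros_def)
qed

text \<open>An error bound that holds only up to distance \<open>r\<close> still bounds the residual from below
  farther away: the resolvent path \<open>t \<mapsto> J t\<close> of \<open>p\<close> is Lipschitz, has residuals at most
  \<open>norm v\<close>, and approaches the zeros, so it meets the distance \<open>r\<close> on its way.\<close>

lemma local_error_bound_extends:
  assumes ne: "zeros \<noteq> {}" and "0 < r"
    and eb: "\<And>p v. infdist p zeros \<le> r \<Longrightarrow> v \<in> T p \<Longrightarrow> infdist p zeros \<le> \<kappa> * norm v"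
    and "0 \<le> \<kappa>" and v: "v \<in> T p"
  shows "min r (infdist p zeros) \<le> \<kappa> * norm v"
proof (cases "infdist p zeros \<le> r")
  case True
  then show ?thesis using eb[OF True v] by simp
next
  case False
  obtain J0 where J0: "\<And>t. 0 < t \<Longrightarrow> (1 / t) *\<^sub>R (p - J0 t) \<in> T (J0 t)"
    using resolvent[of _ p] by metis
  \<comment> \<open>Resolvent path and Yosida approximation. The values at \<open>t = 0\<close> make
    the path start at \<open>p\<close> and keep \<open>J t = p - t *\<^sub>R w t\<close> valid
    there.\<close>
  define J where "J t = (if t = 0 then p else J0 t)" for t
  define w where "w t = (if t = 0 then v else (1 / t) *\<^sub>R (p - J0 t))" for t :: real
  have w: "w t \<in> T (J t)" if "0 \<le> t" for t
    using that J0 v by (auto simp: w_def J_def)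
  have J: "J t = p - t *\<^sub>R w t" for t
    by (auto simp: w_def J_def)
  \<comment> \<open>Monotonicity between two times and Cauchy-Schwarz; together with
    \<open>wv\<close> this makes \<open>J\<close> Lipschitz down to \<open>t = 0\<close>.\<close>
  have step: "s * norm (w s - w t) \<le> \<bar>s - t\<bar> * norm (w t)" if "0 \<le> s" "0 \<le> t" for s t
  proof -
    have "0 \<le> (w t - w s) \<bullet> (J t - J s)"
      using w that by (intro monotone) auto
    also have "J t - J s = (s - t) *\<^sub>R w t - s *\<^sub>R (w t - w s)"
      by (simp add: J algebra_simps)
    finally have "s * norm (w t - w s) ^ 2 \<le> (s - t) * ((w t - w s) \<bullet> w t)"
      by (simp add: inner_diff_right power2_norm_eq_inner)
    also have "\<dots> \<le> \<bar>s - t\<bar> * \<bar>(w t - w s) \<bullet> w t\<bar>"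
      unfolding abs_mult[symmetric] by (rule abs_ge_self)
    also have "\<dots> \<le> \<bar>s - t\<bar> * (norm (w t - w s) * norm (w t))"
      by (intro mult_left_mono Cauchy_Schwarz_ineq2) simp
    finally have "norm (w t - w s) * (s * norm (w t - w s)) \<le> norm (w t - w s) * (\<bar>s - t\<bar> * norm (w t))"
      by (simp add: power2_eq_square mult_ac)
    then show ?thesis
      by (cases "w t = w s") (auto simp: norm_minus_commute)
  qed
  have wv: "norm (w t) \<le> norm v" if "0 \<le> t" for t
  proof (cases "t = 0")
    case False
    have "0 \<le> (w t - v) \<bullet> (J t - p)"
      using that w v by (intro monotone) auto
    then have "t * ((w t - v) \<bullet> w t) \<le> 0"
      by (simp add: J)
    then have "w t \<bullet> w t \<le> v \<bullet> w t"
      using that False by (simp add: mult_le_0_iff inner_diff_left)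
    then have "norm (w t) * norm (w t) \<le> norm v * norm (w t)"
      using Cauchy_Schwarz_ineq2[of v "w t"] by (simp add: norm_eq_sqrt_inner)
    then show ?thesis
      by (cases "w t = 0") auto
  qed (simp add: w_def)
  have lip: "dist (J t) (J s) \<le> (2 * norm v) * dist t s" if "0 \<le> s" "0 \<le> t" for s t
  proof -
    have "J t - J s = s *\<^sub>R (w s - w t) + (s - t) *\<^sub>R w t"
      by (simp add: J algebra_simps)
    then have "dist (J t) (J s) \<le> s * norm (w s - w t) + \<bar>s - t\<bar> * norm (w t)"
      using norm_triangle_ineq[of "s *\<^sub>R (w s - w t)" "(s - t) *\<^sub>R w t"] that
      by (simp add: dist_norm)
    also have "\<dots> \<le> 2 * (\<bar>s - t\<bar> * norm (w t))"
      using step[OF that] by linarith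
    also have "\<dots> \<le> 2 * (\<bar>s - t\<bar> * norm v)"
      using wv[OF that(2)] by (simp add: mult_left_mono)
    finally show ?thesis
      by (simp add: dist_real_def abs_minus_commute mult_ac)
  qed
  have "(2 * norm v)-lipschitz_on {0..} J"
    by (rule lipschitz_onI) (simp_all add: lip)
  then have cont: "continuous_on {0..} J"
    by (rule lipschitz_on_continuous_on)
  obtain s where s: "0 \<in> T s"
    using ne by (auto simp: zeros_def)
  \<comment> \<open>The path never moves away from a zero. The resulting boundedness gives both a
    convergent subsequence and the decay of \<open>w\<close>.\<close>
  have bdd: "norm (J t - s) \<le> norm (p - s)" if "0 \<le> t" for t
  proof -
    have "0 \<le> (w t - 0) \<bullet> (J t - s)"
      using w[OF that] s by (rule monotone)
    then have "0 \<le> (p - J t) \<bullet> (J t - s)"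
      using that by (simp add: J)
    then have "(J t - s) \<bullet> (J t - s) \<le> (p - s) \<bullet> (J t - s)"
      by (simp add: algebra_simps)
    then have "norm (J t - s) * norm (J t - s) \<le> norm (p - s) * norm (J t - s)"
      using Cauchy_Schwarz_ineq2[of "p - s" "J t - s"] by (simp add: norm_eq_sqrt_inner)
    then show ?thesis
      by (cases "J t = s") auto
  qed
  define q where "q n = J (real (Suc n))" for n
  have "bounded (range q)"
    unfolding bounded_iff
  proof (intro exI ballI)
    fix u assume "u \<in> range q"
    then obtain n where "u = q n" by auto
    then show "norm u \<le> norm (p - s) + norm s"
      using bdd[of "real (Suc n)"] norm_triangle_ineq[of "u - s" s] by (simp add: q_def)
  qed
  then obtain l f where f: "strict_mono f" and ql: "(q \<circ> f) \<longlonglongrightarrow> l"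
    using bounded_imp_convergent_subsequence[of q] by auto
  \<comment> \<open>\<open>t *\<^sub>R w t = p - J t\<close> stays bounded, so \<open>w t\<close>
    decays like \<open>1 / t\<close>.\<close>
  have w0: "(\<lambda>n. w (real (Suc n))) \<longlonglongrightarrow> 0"
  proof (rule Lim_null_comparison)
    show "\<forall>\<^sub>F n in sequentially.
        norm (w (real (Suc n))) \<le> (2 * norm (p - s)) * inverse (real (Suc n))"
    proof (intro always_eventually allI)
      fix n
      have "real (Suc n) *\<^sub>R w (real (Suc n)) = (p - s) - (J (real (Suc n)) - s)"
        by (simp add: J)
      then have "real (Suc n) * norm (w (real (Suc n))) \<le> 2 * norm (p - s)"
        using bdd[of "real (Suc n)"] norm_scaleR[of "real (Suc n)" "w (real (Suc n))"]
          norm_triangle_ineq4[of "p - s" "J (real (Suc n)) - s"]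
        by (simp del: of_nat_Suc norm_scaleR)
      then show "norm (w (real (Suc n))) \<le> (2 * norm (p - s)) * inverse (real (Suc n))"
        by (simp add: field_simps)
    qed
    show "(\<lambda>n. (2 * norm (p - s)) * inverse (real (Suc n))) \<longlonglongrightarrow> 0"
      using tendsto_mult[OF tendsto_const LIMSEQ_inverse_real_of_nat] by fastforce
  qed
  have "l \<in> zeros"
  proof (rule zeros_limit)
    show "w (real (Suc (f n))) \<in> T ((q \<circ> f) n)" for n
      using w[of "real (Suc (f n))"] by (simp add: q_def)
    show "(\<lambda>n. w (real (Suc (f n)))) \<longlonglongrightarrow> 0"
      using LIMSEQ_subseq_LIMSEQ[OF w0 f] by (simp add: o_def)
  qed (rule ql)
  have "(\<lambda>n. infdist ((q \<circ> f) n) zeros) \<longlonglongrightarrow> infdist l zeros"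
    by (intro tendsto_infdist ql)
  then have "(\<lambda>n. infdist ((q \<circ> f) n) zeros) \<longlonglongrightarrow> 0"
    using \<open>l \<in> zeros\<close> by simp
  then have "\<forall>\<^sub>F n in sequentially. infdist ((q \<circ> f) n) zeros < r"
    using \<open>0 < r\<close> by (rule order_tendstoD)
  then obtain N where "infdist (q (f N)) zeros < r"
    by (auto simp: eventually_sequentially)
  then obtain t1 where t1: "0 \<le> t1" "infdist (J t1) zeros \<le> r"
    by (metis q_def less_imp_le of_nat_0_le_iff)
  \<comment> \<open>The distance exceeds \<open>r\<close> at time 0 and is at most \<open>r\<close>
    at \<open>t1\<close>. At a time where it equals \<open>r\<close> the assumed error bound
    applies.\<close>
  have "continuous_on {0..t1} (\<lambda>t. infdist (J t) zeros)"
    by (intro continuous_on_infdist continuous_on_subset[OF cont]) auto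
  moreover have "r \<le> infdist (J 0) zeros"
    using False by (simp add: J_def)
  ultimately obtain t where t: "0 \<le> t" "infdist (J t) zeros = r"
    using IVT2'[of "\<lambda>t. infdist (J t) zeros" t1 r 0] t1 by auto
  then have "r \<le> \<kappa> * norm (w t)"
    using eb[of "J t" "w t"] w[of t] by simp
  also have "\<dots> \<le> \<kappa> * norm v"
    using wv[OF t(1)] \<open>0 \<le> \<kappa>\<close> by (rule mult_left_mono)
  finally show ?thesis
    by simp
qed

text \<open>Since \<open>0\<close> lies in \<open>T s\<close>, monotonicity makes the cross term
  nonnegative when the square of \<open>L (p - s) = L (P - s) + L (p - P)\<close> is
  expanded.\<close>

lemma weighted_resolvent_fejer:
  assumes L: "linear L" "\<And>p q. p \<bullet> R q = L p \<bullet> L q" and "0 < \<beta>"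
    and P: "(1 / \<beta>) *\<^sub>R R (p - P) \<in> T P" and s: "s \<in> zeros"
  shows "norm (L (P - s)) ^ 2 + norm (L (p - P)) ^ 2 \<le> norm (L (p - s)) ^ 2"
proof -
  have "0 \<le> ((1 / \<beta>) *\<^sub>R R (p - P) - 0) \<bullet> (P - s)"
    using P s by (intro monotone) (auto simp: zeros_def)
  also have "\<dots> = (1 / \<beta>) * (L (P - s) \<bullet> L (p - P))"
    by (simp add: L inner_commute[of "R _"])
  finally have "0 \<le> L (P - s) \<bullet> L (p - P)"
    using \<open>0 < \<beta>\<close> by (simp add: zero_le_divide_iff)
  moreover have "L (p - s) = L (P - s) + L (p - P)"
    using L(1) by (simp add: linear_diff)
  ultimately show ?thesis
    by (simp add: power2_norm_eq_inner inner_add_left inner_add_right inner_commute)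
qed

text \<open>Monotonicity between \<open>q\<close> and the exact step \<open>P\<close> bounds the
  squared weighted distance by \<open>\<beta> * (e \<bullet> (q - P))\<close>; the constant
  \<open>m\<close> converts the remaining Euclidean norm into the weighted one.\<close>

lemma inexact_resolvent_dist:
  assumes L: "linear L" "\<And>p q. p \<bullet> R q = L p \<bullet> L q" and "0 < \<beta>"
    and m: "\<And>p. m * norm p \<le> norm (L p)" "0 < m"
    and P: "(1 / \<beta>) *\<^sub>R R (p - P) \<in> T P"
    and q: "e + (1 / \<beta>) *\<^sub>R R (p - q) \<in> T q"
  shows "norm (L (q - P)) \<le> \<beta> * norm e / m"
proof -
  have "0 \<le> (e + (1 / \<beta>) *\<^sub>R R (p - q) - (1 / \<beta>) *\<^sub>R R (p - P)) \<bullet> (q - P)"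
    using q P by (rule monotone)
  also have "\<dots> = e \<bullet> (q - P) + (1 / \<beta>) * (L (q - P) \<bullet> (L (p - q) - L (p - P)))"
  proof -
    have R: "R u \<bullet> (q - P) = L (q - P) \<bullet> L u" for u
      by (metis L(2) inner_commute)
    have "(e + (1 / \<beta>) *\<^sub>R a - (1 / \<beta>) *\<^sub>R b) \<bullet> h = e \<bullet> h + (1 / \<beta>) * (a \<bullet> h - b \<bullet> h)" for a b h :: 'a
      by (simp add: inner_add_left inner_diff_left diff_divide_distrib)
    then show ?thesis
      by (simp only: R inner_diff_right[of "L (q - P)"])
  qed
  also have "L (p - q) - L (p - P) = - L (q - P)"
    using L(1) by (simp add: linear_diff)
  finally have "norm (L (q - P)) ^ 2 \<le> \<beta> * (e \<bullet> (q - P))"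
    using \<open>0 < \<beta>\<close> by (simp add: power2_norm_eq_inner field_simps)
  also have "\<dots> \<le> \<beta> * (norm e * norm (q - P))"
    using \<open>0 < \<beta>\<close> by (intro mult_left_mono norm_cauchy_schwarz) auto
  also have "\<dots> \<le> \<beta> * (norm e * (norm (L (q - P)) / m))"
    using \<open>0 < \<beta>\<close> m by (intro mult_left_mono) (auto simp: field_simps)
  finally have "norm (L (q - P)) * norm (L (q - P)) \<le> (\<beta> * norm e / m) * norm (L (q - P))"
    by (simp add: power2_eq_square mult_ac)
  moreover have "0 \<le> \<beta> * norm e / m"
    using \<open>0 < \<beta>\<close> m by simp
  ultimately show ?thesis
    using mult_right_le_imp_le[of "norm (L (q - P))" "norm (L (q - P))" "\<beta> * norm e / m"]
    by (cases "L (q - P) = 0") simp_all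
qed

text \<open>Here \<open>g\<close> is \<open>sqrt (\<gamma>_of \<tau>)\<close> when \<open>R = R_op \<tau>\<close>.\<close>

lemma weighted_resolvent_contraction:
  assumes L: "linear L" "\<And>p q. p \<bullet> R q = L p \<bullet> L q" and "0 < \<beta>"
    and g: "\<And>p. norm (L p) \<le> g * norm p" "\<And>p. norm (R p) \<le> g * norm (L p)" "1 \<le> g"
    and P: "(1 / \<beta>) *\<^sub>R R (p - P) \<in> T P"
    and ne: "zeros \<noteq> {}" and "0 < r" "0 < \<kappa>"
    and eb: "\<And>p v. infdist p zeros \<le> r \<Longrightarrow> v \<in> T p \<Longrightarrow> infdist p zeros \<le> \<kappa> * norm v"
    and near: "infdist (L p) (L ` zeros) \<le> r"
  shows "infdist (L P) (L ` zeros)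
      \<le> \<kappa> * g\<^sup>2 / sqrt (\<beta>\<^sup>2 + \<kappa>\<^sup>2 * (g\<^sup>2)\<^sup>2) * infdist (L p) (L ` zeros)"
    and "infdist (L P) (L ` zeros) \<le> infdist (L p) (L ` zeros)"
    and "norm (L (p - P)) \<le> infdist (L p) (L ` zeros)"
proof -
  define dP where "dP = infdist (L P) (L ` zeros)"
  define d where "d = infdist (L p) (L ` zeros)"
  define n where "n = norm (L (p - P))"
  have nonneg: "0 \<le> dP" "0 \<le> d" "0 \<le> n"
    by (simp_all add: dP_def d_def n_def infdist_nonneg)
  have Ldist: "dist (L a) (L b) = norm (L (a - b))" for a b
    using L(1) by (simp add: dist_norm linear_diff)
  \<comment> \<open>The Pythagorean inequality holds for each zero \<open>s\<close>; under the
    square root it is a lower bound on distances and passes to their infimum.\<close>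
  have "sqrt (dP\<^sup>2 + n\<^sup>2) \<le> d"
    unfolding d_def
  proof (rule le_infdist)
    fix u assume "u \<in> L ` zeros"
    then obtain s where s: "s \<in> zeros" "u = L s" by auto
    have "dP \<le> norm (L (P - s))"
      unfolding dP_def Ldist[symmetric] using s by (intro infdist_le) auto
    then have "dP\<^sup>2 + n\<^sup>2 \<le> norm (L (p - s)) ^ 2"
      using weighted_resolvent_fejer[OF L \<open>0 < \<beta>\<close> P s(1)] nonneg
      by (simp add: n_def) (smt (verit, best) power_mono)
    then show "sqrt (dP\<^sup>2 + n\<^sup>2) \<le> dist (L p) u"
      unfolding s Ldist by (simp add: real_le_lsqrt)
  qed (use ne in auto)
  then have "(sqrt (dP\<^sup>2 + n\<^sup>2))\<^sup>2 \<le> d\<^sup>2"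
    by (intro power_mono) auto
  then have pyth: "dP\<^sup>2 + n\<^sup>2 \<le> d\<^sup>2"
    by simp
  show "infdist (L P) (L ` zeros) \<le> infdist (L p) (L ` zeros)"
    "norm (L (p - P)) \<le> infdist (L p) (L ` zeros)"
    unfolding dP_def[symmetric] d_def[symmetric] n_def[symmetric]
  proof -
    have "dP\<^sup>2 \<le> d\<^sup>2" "n\<^sup>2 \<le> d\<^sup>2"
      using pyth zero_le_power2[of dP] zero_le_power2[of n] by linarith+
    then show "dP \<le> d" "n \<le> d"
      using nonneg(2) by (auto intro: power2_le_imp_le)
  qed
  then have "dP \<le> r"
    using near by (simp add: dP_def)
  define v where "v = (1 / \<beta>) *\<^sub>R R (p - P)"
  have "norm v \<le> g * n / \<beta>"
    using \<open>0 < \<beta>\<close> g(2)[of "p - P"] by (simp add: v_def n_def divide_right_mono)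
  \<comment> \<open>One factor \<open>g\<close> arises here, from weighted to Euclidean distance,
    and another in the bound on \<open>norm v\<close>; hence \<open>g\<^sup>2\<close> in the
    rate.\<close>
  have "dP \<le> g * infdist P zeros"
  proof -
    have "dP / g \<le> infdist P zeros"
    proof (rule le_infdist[OF ne])
      fix s assume "s \<in> zeros"
      then have "dP \<le> norm (L (P - s))"
        unfolding dP_def Ldist[symmetric] by (intro infdist_le) auto
      also have "\<dots> \<le> g * dist P s"
        using g(1)[of "P - s"] by (simp add: dist_norm)
      finally show "dP / g \<le> dist P s"
        using g(3) by (simp add: field_simps)
    qed
    then show ?thesis
      using g(3) by (simp add: field_simps)
  qed
  \<comment> \<open>If the Euclidean distance exceeds \<open>r\<close>, the estimate
    \<open>dP \<le> r \<le> g * r\<close> replaces it, so the truncated error bound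
    suffices.\<close>
  moreover have "r \<le> g * r"
    using g(3) \<open>0 < r\<close> by simp
  ultimately have "dP \<le> g * min r (infdist P zeros)"
    using \<open>dP \<le> r\<close> by (simp add: min_def)
  also have "\<dots> \<le> g * (\<kappa> * norm v)"
  proof (intro mult_left_mono)
    show "min r (infdist P zeros) \<le> \<kappa> * norm v"
      using local_error_bound_extends[of r \<kappa> v P] ne \<open>0 < r\<close> \<open>0 < \<kappa>\<close> eb P
      by (auto simp: v_def)
  qed (use g(3) in auto)
  also have "\<dots> \<le> g * (\<kappa> * (g * n / \<beta>))"
    using g(3) \<open>0 < \<kappa>\<close> \<open>norm v \<le> _\<close> by (intro mult_left_mono) auto
  finally have "\<beta> * dP \<le> (\<kappa> * g\<^sup>2) * n"
    using \<open>0 < \<beta>\<close> by (simp add: field_simps power2_eq_square)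
  \<comment> \<open>Squaring, inserting \<open>n\<^sup>2 \<le> d\<^sup>2 - dP\<^sup>2\<close> and
    collecting \<open>dP\<^sup>2\<close> produces the square root in the contraction factor.\<close>
  then have "(\<beta> * dP)\<^sup>2 \<le> ((\<kappa> * g\<^sup>2) * n)\<^sup>2"
    using nonneg \<open>0 < \<beta>\<close> by (intro power_mono) auto
  also have "\<dots> \<le> (\<kappa> * g\<^sup>2)\<^sup>2 * (d\<^sup>2 - dP\<^sup>2)"
    unfolding power_mult_distrib[of _ n] using pyth by (intro mult_left_mono) auto
  finally have "(\<beta>\<^sup>2 + \<kappa>\<^sup>2 * (g\<^sup>2)\<^sup>2) * dP\<^sup>2 \<le> (\<kappa> * g\<^sup>2 * d)\<^sup>2"
    by (simp add: power_mult_distrib algebra_simps)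
  then have "sqrt ((\<beta>\<^sup>2 + \<kappa>\<^sup>2 * (g\<^sup>2)\<^sup>2) * dP\<^sup>2) \<le> sqrt ((\<kappa> * g\<^sup>2 * d)\<^sup>2)"
    by (rule real_sqrt_le_mono)
  then have "sqrt (\<beta>\<^sup>2 + \<kappa>\<^sup>2 * (g\<^sup>2)\<^sup>2) * dP \<le> \<kappa> * g\<^sup>2 * d"
    using nonneg \<open>0 < \<kappa>\<close> by (simp add: real_sqrt_mult)
  moreover have "0 < sqrt (\<beta>\<^sup>2 + \<kappa>\<^sup>2 * (g\<^sup>2)\<^sup>2)"
    using \<open>0 < \<beta>\<close> by (simp add: add_pos_nonneg)
  ultimately show "infdist (L P) (L ` zeros)
      \<le> \<kappa> * g\<^sup>2 / sqrt (\<beta>\<^sup>2 + \<kappa>\<^sup>2 * (g\<^sup>2)\<^sup>2) * infdist (L p) (L ` zeros)"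
    unfolding dP_def[symmetric] d_def[symmetric] by (simp add: field_simps)
qed

end

section \<open>The block weights \<open>R_op\<close>\<close>

lemma R_op_apply: "R_op s (a, b, c) = (s *\<^sub>R a, b, c)"
  by (simp add: R_op_def)

lemma linear_R_op: "linear (R_op s)"
  by (rule linearI) (auto simp: R_op_def algebra_simps)

lemma inner_R_op: "0 \<le> \<tau> \<Longrightarrow> p \<bullet> R_op \<tau> q = R_op (sqrt \<tau>) p \<bullet> R_op (sqrt \<tau>) q"
  by (cases p; cases q) (simp add: R_op_apply)

lemma norm_wrt_R_op: "0 \<le> \<tau> \<Longrightarrow> norm_wrt (R_op \<tau>) p = norm (R_op (sqrt \<tau>) p)"
  by (simp add: norm_wrt_def inner_R_op[of \<tau> p p] norm_eq_sqrt_inner)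

lemma norm_R_op_sq: "norm (R_op s (a, b, c)) ^ 2 = s\<^sup>2 * norm a ^ 2 + norm b ^ 2 + norm c ^ 2"
  by (simp add: R_op_apply norm_Pair power_mult_distrib)

text \<open>The squared norms compare block by block: the first block uses the relation between
  \<open>s\<close> and \<open>t\<close>, the two unweighted blocks use
  \<open>1 \<le> g\<close>.\<close>

lemma norm_R_op_le:
  assumes "\<bar>s\<bar> \<le> g * \<bar>t\<bar>" "1 \<le> g"
  shows "norm (R_op s p) \<le> g * norm (R_op t p)"
proof -
  obtain a b c where p: "p = (a, b, c)" by (cases p)
  have s: "s\<^sup>2 \<le> g\<^sup>2 * t\<^sup>2"
    using power_mono[OF assms(1), of 2] by (simp add: power_mult_distrib)
  have g: "1 \<le> g\<^sup>2"
    using assms(2) by (simp add: one_le_power)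
  have "norm (R_op s p) ^ 2 \<le> g\<^sup>2 * (t\<^sup>2 * norm a ^ 2) + g\<^sup>2 * norm b ^ 2 + g\<^sup>2 * norm c ^ 2"
    unfolding p norm_R_op_sq using mult_right_mono[OF s, of "norm a ^ 2"]
      mult_right_mono[OF g, of "norm b ^ 2"] mult_right_mono[OF g, of "norm c ^ 2"]
    by (simp add: mult.assoc)
  also have "\<dots> = (g * norm (R_op t p)) ^ 2"
    unfolding p power_mult_distrib norm_R_op_sq by (simp add: algebra_simps)
  finally show ?thesis
    using assms(2) by (intro power2_le_imp_le[of "norm (R_op s p)"]) auto
qed

lemma R_op_1: "R_op 1 p = p"
  by (cases p) (simp add: R_op_apply)

lemma norm_R_op_mono: "\<bar>s\<bar> \<le> \<bar>t\<bar> \<Longrightarrow> norm (R_op s p) \<le> norm (R_op t p)"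
  using norm_R_op_le[of s 1 t p] by simp

lemma sqrt_\<gamma>_of: "sqrt (\<gamma>_of \<tau>) = max (sqrt \<tau>) 1"
  by (auto simp: \<gamma>_of_def max_def)

lemma norm_R_op_upper:
  assumes "0 \<le> \<tau>"
  shows "norm (R_op (sqrt \<tau>) p) \<le> sqrt (\<gamma>_of \<tau>) * norm p"
    and "norm (R_op \<tau> p) \<le> sqrt (\<gamma>_of \<tau>) * norm (R_op (sqrt \<tau>) p)"
proof -
  show "norm (R_op (sqrt \<tau>) p) \<le> sqrt (\<gamma>_of \<tau>) * norm p"
    using norm_R_op_le[of "sqrt \<tau>" "sqrt (\<gamma>_of \<tau>)" 1 p] assms
    by (simp add: sqrt_\<gamma>_of R_op_1)
  have "sqrt \<tau> * sqrt \<tau> \<le> max (sqrt \<tau>) 1 * sqrt \<tau>"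
    using assms by (intro mult_right_mono) auto
  then show "norm (R_op \<tau> p) \<le> sqrt (\<gamma>_of \<tau>) * norm (R_op (sqrt \<tau>) p)"
    using norm_R_op_le[of \<tau> "sqrt (\<gamma>_of \<tau>)" "sqrt \<tau>" p] assms
    by (simp add: sqrt_\<gamma>_of)
qed

lemma norm_R_op_lower:
  assumes "0 < \<tau>"
  shows "min (sqrt \<tau>) 1 * norm p \<le> norm (R_op (sqrt \<tau>) p)"
proof -
  have "1 \<le> inverse (min (sqrt \<tau>) 1) * sqrt \<tau>"
    using assms by (auto simp: min_def field_simps)
  moreover have "1 \<le> inverse (min (sqrt \<tau>) 1)"
    using assms by (intro one_le_inverse) auto
  ultimately have "norm p \<le> inverse (min (sqrt \<tau>) 1) * norm (R_op (sqrt \<tau>) p)"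
    using norm_R_op_le[of 1 "inverse (min (sqrt \<tau>) 1)" "sqrt \<tau>" p] assms by (simp add: R_op_1)
  then show ?thesis
    using assms by (simp add: field_simps)
qed

section \<open>Existence and optimality of minimisers\<close>

text \<open>The quadratic beats the affine lower bound outside a ball around \<open>w\<close>, so a
  minimiser over that compact ball is global.\<close>

lemma quadratic_dominates_linear:
  fixes f :: "'a::euclidean_space \<Rightarrow> real"
  assumes cont: "continuous_on UNIV f" and lb: "\<And>x. l \<bullet> x + c \<le> f x" and "0 < a"
  shows "\<exists>x. \<forall>y. f x + a * norm (x - w) ^ 2 \<le> f y + a * norm (y - w) ^ 2"
proof -
  define h where "h y = f y + a * norm (y - w) ^ 2" for y
  \<comment> \<open>\<open>a * B\<close> covers the slope \<open>norm l\<close> plus the gap between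
    \<open>f w\<close> and the affine bound at \<open>w\<close>. The extra \<open>a\<close> ensures
    \<open>1 \<le> B\<close>, so outside the ball the gap may be multiplied by
    \<open>n\<close>.\<close>
  define B where "B = (norm l + \<bar>f w - l \<bullet> w - c\<bar> + a) / a"
  have "1 \<le> B"
    using \<open>0 < a\<close> by (simp add: B_def)
  have "continuous_on (cball w B) h"
    unfolding h_def by (intro continuous_intros continuous_on_subset[OF cont]) auto
  moreover have "w \<in> cball w B"
    using \<open>1 \<le> B\<close> by simp
  ultimately obtain x where x: "x \<in> cball w B" "\<And>y. y \<in> cball w B \<Longrightarrow> h x \<le> h y"
    using continuous_attains_inf[of "cball w B" h] by (metis compact_cball empty_iff)
  have "h x \<le> h y" for y
  proof (cases "y \<in> cball w B")
    case False
    define n where "n = norm (y - w)"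
    have n: "B < n" "1 \<le> n"
      using False \<open>1 \<le> B\<close> by (simp_all add: n_def dist_norm norm_minus_commute)
    have "h x \<le> f w"
      using x(2)[OF \<open>w \<in> cball w B\<close>] by (simp add: h_def)
    also have "\<dots> \<le> l \<bullet> w + c + \<bar>f w - l \<bullet> w - c\<bar> * n"
      using mult_left_mono[OF n(2) abs_ge_zero[of "f w - l \<bullet> w - c"]] by simp
    also have "\<bar>f w - l \<bullet> w - c\<bar> \<le> a * B - norm l"
      using \<open>0 < a\<close> by (simp add: B_def)
    also have "a * B \<le> a * n"
      using n \<open>0 < a\<close> by simp
    finally have "h x \<le> l \<bullet> w + c - norm l * n + a * n\<^sup>2"
      using n by (simp add: algebra_simps power2_eq_square)
    moreover have "- (norm l * n) \<le> l \<bullet> y - l \<bullet> w"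
      using Cauchy_Schwarz_ineq2[of l "y - w"] by (simp add: n_def inner_diff_right)
    ultimately have "h x \<le> l \<bullet> y + c + a * n\<^sup>2"
      by linarith
    then show ?thesis
      using lb[of y] by (simp add: h_def n_def)
  qed (rule x(2))
  then show ?thesis
    by (intro exI[of _ x] allI) (simp add: h_def)
qed

text \<open>Fermat's rule for a sum; the quadratic upper model replaces differentiability of \<open>f\<close>.\<close>

lemma minimizer_subgradient:
  fixes f g :: "'a::real_inner \<Rightarrow> real"
  assumes min: "\<And>y. f x + g x \<le> f y + g y"
    and conv: "convex_on UNIV g"
    and upper: "\<And>h t. 0 < t \<Longrightarrow> f (x + t *\<^sub>R h) \<le> f x + t * (d \<bullet> h) + t\<^sup>2 * C h"
  shows "g x - d \<bullet> (y - x) \<le> g y"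
proof -
  define h where "h = y - x"
  \<comment> \<open>Convexity of \<open>g\<close> along the segment, divided by \<open>t\<close>;
    the remainder \<open>t * C h\<close> vanishes as \<open>t\<close> tends to 0 from the
    right.\<close>
  have "0 \<le> d \<bullet> h + g y - g x + t * C h" if t: "0 < t" "t \<le> 1" for t
  proof -
    have "x + t *\<^sub>R h = (1 - t) *\<^sub>R x + t *\<^sub>R y"
      by (simp add: h_def algebra_simps)
    then have "g (x + t *\<^sub>R h) \<le> (1 - t) * g x + t * g y"
      using convex_onD[OF conv, of t x y] t by simp
    then have "0 \<le> t * (d \<bullet> h) + t\<^sup>2 * C h + (1 - t) * g x + t * g y - g x"
      using min[of "x + t *\<^sub>R h"] upper[OF t(1), of h] by linarith
    also have "\<dots> = t * (d \<bullet> h + g y - g x + t * C h)"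
      by (simp add: algebra_simps power2_eq_square)
    finally show ?thesis
      using t by (simp add: zero_le_mult_iff)
  qed
  then have "\<forall>\<^sub>F t in at_right 0. 0 \<le> d \<bullet> h + g y - g x + t * C h"
    by (auto simp: eventually_at_right[of 0 "1::real"] intro!: exI[of _ 1])
  moreover have "((\<lambda>t. d \<bullet> h + g y - g x + t * C h) \<longlongrightarrow> d \<bullet> h + g y - g x + 0 * C h) (at_right 0)"
    by (intro tendsto_intros)
  ultimately have "0 \<le> d \<bullet> h + g y - g x + 0 * C h"
    by (intro tendsto_lowerbound[where F = "at_right 0"]) auto
  then show ?thesis
    by (simp add: h_def)
qed

section \<open>The weighted l1 norm, support functions and the box\<close>

lemma convex_on_norm1_matrix:
  fixes D :: "real^'n^'m"
  shows "convex_on UNIV (\<lambda>x. norm1 (D *v x))"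
proof (rule convex_onI)
  fix t and x y :: "real^'n" assume t: "0 < t" "t < (1::real)"
  have abs: "\<bar>(1 - t) * u + t * v\<bar> \<le> (1 - t) * \<bar>u\<bar> + t * \<bar>v\<bar>" for u v :: real
    using abs_triangle_ineq[of "(1 - t) * u" "t * v"] t by (simp add: abs_mult)
  have "norm1 (D *v ((1 - t) *\<^sub>R x + t *\<^sub>R y))
      = (\<Sum>i\<in>UNIV. \<bar>(1 - t) * (D *v x) $ i + t * (D *v y) $ i\<bar>)"
    by (simp add: norm1_def matrix_vector_right_distrib matrix_vector_mult_scaleR)
  also have "\<dots> \<le> (\<Sum>i\<in>UNIV. (1 - t) * \<bar>(D *v x) $ i\<bar> + t * \<bar>(D *v y) $ i\<bar>)"
    by (intro sum_mono abs)
  also have "\<dots> = (1 - t) * norm1 (D *v x) + t * norm1 (D *v y)"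
    by (simp add: norm1_def sum.distrib sum_distrib_left)
  finally show "norm1 (D *v ((1 - t) *\<^sub>R x + t *\<^sub>R y))
      \<le> (1 - t) * norm1 (D *v x) + t * norm1 (D *v y)" .
qed auto

lemma norm1_nonneg: "0 \<le> norm1 v"
  by (simp add: norm1_def sum_nonneg)

lemma continuous_on_norm1_matrix: "continuous_on S (\<lambda>x. norm1 (D *v x))"
  unfolding norm1_def
  by (rule continuous_on_sum, rule continuous_on_rabs, rule continuous_on_component,
      rule matrix_vector_mult_linear_continuous_on)

lemma subdifferential_g_fun_iff:
  "v \<in> subdifferential (g_fun D) x \<longleftrightarrow> (\<forall>y. norm1 (D *v x) + v \<bullet> (y - x) \<le> norm1 (D *v y))"
  by (simp add: subdifferential_def g_fun_def)

text \<open>Adding the two subgradient inequalities cancels the function values, which is legitimate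
  because both are finite.\<close>

lemma subdifferential_monotone:
  assumes "u \<in> subdifferential f x" "v \<in> subdifferential f y"
    and "\<bar>f x\<bar> \<noteq> \<infinity>" "\<bar>f y\<bar> \<noteq> \<infinity>"
  shows "0 \<le> (u - v) \<bullet> (x - y)"
proof -
  have "f x + ereal (u \<bullet> (y - x)) \<le> f y" "f y + ereal (v \<bullet> (x - y)) \<le> f x"
    using assms by (auto simp: subdifferential_def)
  then have "u \<bullet> (y - x) + v \<bullet> (x - y) \<le> 0"
    using assms(3,4) by (cases "f x"; cases "f y") auto
  then show ?thesis
    by (simp add: inner_diff_left inner_diff_right)
qed

text \<open>The second assumption puts \<open>v\<close> in the normal cone of \<open>K\<close> at
  \<open>p\<close>, so \<open>p\<close> attains the supremum.\<close>

lemma fenchel_conjugate_indicator: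
  assumes "p \<in> K" "\<And>k. k \<in> K \<Longrightarrow> v \<bullet> (k - p) \<le> 0"
  shows "fenchel_conjugate (indicator_fun K) v = ereal (v \<bullet> p)"
  unfolding fenchel_conjugate_def
proof (rule antisym)
  show "(SUP x. ereal (v \<bullet> x) - indicator_fun K x) \<le> ereal (v \<bullet> p)"
    using assms(2) by (intro SUP_least) (auto simp: indicator_fun_def inner_diff_right)
  show "ereal (v \<bullet> p) \<le> (SUP x. ereal (v \<bullet> x) - indicator_fun K x)"
    using assms(1) by (intro SUP_upper2[of p]) (auto simp: indicator_fun_def)
qed

lemma fenchel_conjugate_indicator_ge:
  "p \<in> K \<Longrightarrow> ereal (v \<bullet> p) \<le> fenchel_conjugate (indicator_fun K) v"
  unfolding fenchel_conjugate_def by (rule SUP_upper2[of p]) (auto simp: indicator_fun_def)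

lemma subdifferential_support_function:
  assumes "p \<in> K" "\<And>k. k \<in> K \<Longrightarrow> v \<bullet> (k - p) \<le> 0"
  shows "p \<in> subdifferential (fenchel_conjugate (indicator_fun K)) v"
  using fenchel_conjugate_indicator_ge[OF assms(1)]
  by (simp add: subdifferential_def fenchel_conjugate_indicator[OF assms]
      inner_diff_right inner_commute)

text \<open>The support function vanishes at 0, so the subgradient inequality tested there excludes
  infinity; any point of \<open>K\<close> excludes minus infinity.\<close>

lemma support_function_finite:
  assumes "K \<noteq> {}" and q: "q \<in> subdifferential (fenchel_conjugate (indicator_fun K)) v"
  shows "\<bar>fenchel_conjugate (indicator_fun K) v\<bar> \<noteq> \<infinity>"
proof -
  obtain k where "k \<in> K"
    using assms(1) by auto
  then have "fenchel_conjugate (indicator_fun K) v \<noteq> - \<infinity>"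
    using fenchel_conjugate_indicator_ge[of k K v] by auto
  moreover have "fenchel_conjugate (indicator_fun K) 0 = 0"
    using fenchel_conjugate_indicator[of k K 0] \<open>k \<in> K\<close> by simp
  then have "fenchel_conjugate (indicator_fun K) v + ereal (q \<bullet> (0 - v)) \<le> 0"
    using q unfolding subdifferential_def by (auto dest: spec[of _ 0])
  then have "fenchel_conjugate (indicator_fun K) v \<noteq> \<infinity>"
    by auto
  ultimately show ?thesis
    by auto
qed

lemma closed_box_set: "closed (box_set al au)"
proof -
  have "box_set al au = (\<Inter>i. {x. al $ i \<le> ereal (x $ i)} \<inter> {x. ereal (x $ i) \<le> au $ i})"
    by (auto simp: box_set_def)
  then show ?thesis
    by (simp only:) (intro closed_INT ballI closed_Int closed_Collect_le
        continuous_on_const continuous_on_ereal continuous_on_component continuous_on_id)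
qed

lemma convex_box_set: "convex (box_set al au)"
proof (rule convexI)
  fix x y u v
  assume xy: "x \<in> box_set al au" "y \<in> box_set al au" and uv: "0 \<le> u" "0 \<le> v" "u + v = (1::real)"
  \<comment> \<open>The estimate is kept among reals, since the bounds of the box may be infinite;
    the lower half is the upper one after negation.\<close>
  have "min (x $ i) (y $ i) \<le> u * x $ i + v * y $ i" "u * x $ i + v * y $ i \<le> max (x $ i) (y $ i)" for i
    using convex_bound_le[of "x $ i" "max (x $ i) (y $ i)" "y $ i" u v] uv
      convex_bound_le[of "- (x $ i)" "- min (x $ i) (y $ i)" "- (y $ i)" u v] by auto
  moreover have "al $ i \<le> ereal (min (x $ i) (y $ i))" "ereal (max (x $ i) (y $ i)) \<le> au $ i" for i
    using xy by (auto simp: box_set_def min_def max_def)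
  ultimately have "al $ i \<le> ereal (u * x $ i + v * y $ i)" "ereal (u * x $ i + v * y $ i) \<le> au $ i" for i
    by (meson ereal_less_eq(3) order_trans)+
  then show "u *\<^sub>R x + v *\<^sub>R y \<in> box_set al au"
    by (simp add: box_set_def)
qed

section \<open>The operator \<open>T_ell\<close> and the subproblem\<close>

lemma inner_transpose_mult: "(transpose A *v y) \<bullet> x = y \<bullet> (A *v x)"
  for A :: "real^'n^'m"
  by (simp add: dot_lmul_matrix)

lemma mem_T_ell_iff:
  "(u, v, w) \<in> T_ell c Q A b D K (x, y, z) \<longleftrightarrow>
    (\<exists>s \<in> subdifferential (g_fun D) x. u = Q *v x + c - transpose A *v y + z + s) \<and>
    v = A *v x - b \<and> w + x \<in> subdifferential (fenchel_conjugate (indicator_fun K)) z"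
  by (auto simp: T_ell_def)

text \<open>The terms with \<open>A\<close> and those coupling \<open>x\<close> with
  \<open>z\<close> are skew and cancel, leaving the quadratic form of \<open>Q\<close> and two
  monotone subgradient terms.\<close>

lemma T_ell_monotone:
  assumes Q: "pos_semidef Q" and K: "K \<noteq> {}"
    and p: "U \<in> T_ell c Q A b D K p" and q: "V \<in> T_ell c Q A b D K q"
  shows "0 \<le> (U - V) \<bullet> (p - q)"
proof -
  obtain u1 v1 w1 u2 v2 w2 where UV: "U = (u1, v1, w1)" "V = (u2, v2, w2)"
    by (cases U; cases V) auto
  obtain x1 y1 z1 x2 y2 z2 where pq: "p = (x1, y1, z1)" "q = (x2, y2, z2)"
    by (cases p; cases q) auto
  from p obtain s1 where 1: "s1 \<in> subdifferential (g_fun D) x1"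
    "u1 = Q *v x1 + c - transpose A *v y1 + z1 + s1" "v1 = A *v x1 - b"
    "w1 + x1 \<in> subdifferential (fenchel_conjugate (indicator_fun K)) z1"
    unfolding UV pq mem_T_ell_iff by auto
  from q obtain s2 where 2: "s2 \<in> subdifferential (g_fun D) x2"
    "u2 = Q *v x2 + c - transpose A *v y2 + z2 + s2" "v2 = A *v x2 - b"
    "w2 + x2 \<in> subdifferential (fenchel_conjugate (indicator_fun K)) z2"
    unfolding UV pq mem_T_ell_iff by auto
  have s: "0 \<le> (s1 - s2) \<bullet> (x1 - x2)"
    using 1(1) 2(1) by (rule subdifferential_monotone) (auto simp: g_fun_def)
  have w: "0 \<le> ((w1 + x1) - (w2 + x2)) \<bullet> (z1 - z2)"
    by (rule subdifferential_monotone[OF 1(4) 2(4)])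
      (rule support_function_finite[OF K 1(4)] support_function_finite[OF K 2(4)])+
  define d e f where def: "d = x1 - x2" "e = y1 - y2" "f = z1 - z2"
  have u12: "u1 - u2 = Q *v d - transpose A *v e + f + (s1 - s2)"
    by (simp add: 1(2) 2(2) def matrix_vector_mult_diff_distrib)
  have v12: "v1 - v2 = A *v d"
    by (simp add: 1(3) 2(3) def matrix_vector_mult_diff_distrib)
  have w12: "w1 - w2 = ((w1 + x1) - (w2 + x2)) - d"
    by (simp add: def)
  have "(U - V) \<bullet> (p - q) = (u1 - u2) \<bullet> d + (v1 - v2) \<bullet> e + (w1 - w2) \<bullet> f"
    by (simp add: UV pq def)
  also have "\<dots> = d \<bullet> (Q *v d) + (s1 - s2) \<bullet> d + ((w1 + x1) - (w2 + x2)) \<bullet> f"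
    unfolding u12 v12 w12 inner_add_left inner_diff_left[of _ d f]
      inner_diff_left[of "Q *v d"] inner_transpose_mult
    by (simp add: inner_commute)
  also have "0 \<le> \<dots>"
    using s w Q by (simp add: def pos_semidef_def)
  finally show ?thesis .
qed

text \<open>This identifies the algorithm as a proximal point method: since \<open>z\<close> is
  updated exactly, a residual of the subproblem is the error of a proximal step for
  \<open>T_ell\<close>, with zero third component.\<close>

lemma F_map_imp_T_ell:
  assumes K: "closed K" "convex K" "K \<noteq> {}" and "0 < \<beta>" "0 < \<tau>"
    and F: "(u, v) \<in> F_map c Q A b D K \<beta> (\<beta> / \<tau>) xk yk zk x y"
    and z: "z = multiplier_update K \<beta> zk x"
  shows "(u, v, 0) + (1 / \<beta>) *\<^sub>R R_op \<tau> ((xk, yk, zk) - (x, y, z)) \<in> T_ell c Q A b D K (x, y, z)"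
proof -
  define w where "w = (1 / \<beta>) *\<^sub>R zk + x"
  define q where "q = closest_point K w"
  have zw: "z = \<beta> *\<^sub>R (w - q)"
    using \<open>0 < \<beta>\<close> by (simp add: z multiplier_update_def w_def q_def algebra_simps)
  obtain s where s: "s \<in> subdifferential (g_fun D) x"
    "u = r_map c Q A K \<beta> (\<beta> / \<tau>) xk zk x y + s" "v = A *v x + (1 / \<beta>) *\<^sub>R (y - yk) - b"
    using F by (auto simp: F_map_def)
  have "q \<in> subdifferential (fenchel_conjugate (indicator_fun K)) z"
  proof (rule subdifferential_support_function)
    show "q \<in> K"
      unfolding q_def using K by (intro closest_point_in_set) auto
    show "z \<bullet> (k - q) \<le> 0" if "k \<in> K" for k
      using closest_point_dot[OF K(2,1) that, of w] \<open>0 < \<beta>\<close>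
      by (simp add: zw q_def mult_le_0_iff)
  qed
  \<comment> \<open>The third proximal residual plus \<open>x\<close> is exactly the projection, to
    which \<open>z\<close> is normal.\<close>
  moreover have "(1 / \<beta>) *\<^sub>R (zk - z) + x = q"
    using \<open>0 < \<beta>\<close> by (simp add: zw w_def algebra_simps)
  moreover have "u + (1 / \<beta>) *\<^sub>R \<tau> *\<^sub>R (xk - x) = Q *v x + c - transpose A *v y + z + s"
    unfolding s(2) r_map_def z[symmetric] by (simp add: algebra_simps)
  moreover have "v + (1 / \<beta>) *\<^sub>R (yk - y) = A *v x - b"
    by (simp add: s(3) algebra_simps)
  ultimately show ?thesis
    using s(1) by (simp add: R_op_apply mem_T_ell_iff)
qed

lemma norm_add_scaleR_sq:
  fixes u h :: "'a::real_inner"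
  shows "norm (u + t *\<^sub>R h) ^ 2 = norm u ^ 2 + 2 * t * (u \<bullet> h) + t\<^sup>2 * norm h ^ 2"
  by (simp only: power2_norm_eq_inner inner_add_left inner_add_right inner_scaleR_left
      inner_scaleR_right inner_commute[of h u]) (simp add: power2_eq_square algebra_simps)

text \<open>The exact step minimises the proximal augmented Lagrangian in \<open>x\<close>, with \<open>y\<close> and \<open>z\<close>
  eliminated; the squared distance to \<open>K\<close> is the Moreau envelope of the indicator of \<open>K\<close>.\<close>

lemma F_map_zero_exists:
  fixes Q D :: "real^'n^'n" and A :: "real^'n^'m"
  assumes Q: "pos_semidef Q" and K: "closed K" "convex K" "K \<noteq> {}" and "0 < \<beta>" "0 < \<tau>"
  shows "\<exists>x y. 0 \<in> F_map c Q A b D K \<beta> (\<beta> / \<tau>) xk yk zk x y"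
proof -
  \<comment> \<open>Half of \<open>1 / \<rho>\<close> for
    \<open>\<rho> = \<beta> / \<tau>\<close>.\<close>
  define a where "a = \<tau> / (2 * \<beta>)"
  define w where "w x = (1 / \<beta>) *\<^sub>R zk + x" for x
  define f where "f x = c \<bullet> x + (1/2) * (x \<bullet> (Q *v x)) - yk \<bullet> (A *v x - b)
    + (\<beta>/2) * norm (A *v x - b) ^ 2 + (\<beta>/2) * norm (w x - closest_point K (w x)) ^ 2" for x
  define g where "g x = norm1 (D *v x)" for x
  have "0 < a"
    using \<open>0 < \<beta>\<close> \<open>0 < \<tau>\<close> by (simp add: a_def)
  have "\<exists>x. \<forall>y. (f x + g x) + a * norm (x - xk) ^ 2 \<le> (f y + g y) + a * norm (y - xk) ^ 2"
  proof (rule quadratic_dominates_linear)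
    have "continuous_on UNIV w"
      unfolding w_def by (intro continuous_intros)
    moreover have "continuous_on UNIV (\<lambda>x. closest_point K (w x))"
      by (rule continuous_on_compose2[OF continuous_on_closest_point[OF K(2,1,3)] \<open>continuous_on UNIV w\<close>])
        auto
    ultimately show "continuous_on UNIV (\<lambda>x. f x + g x)"
      unfolding f_def g_def
      by (intro continuous_intros continuous_on_norm1_matrix matrix_vector_mult_linear_continuous_on)
    show "(c - transpose A *v yk) \<bullet> x + yk \<bullet> b \<le> f x + g x" for x
    proof -
      have "0 \<le> x \<bullet> (Q *v x)"
        using Q by (simp add: pos_semidef_def)
      moreover have "0 \<le> (\<beta>/2) * norm (A *v x - b) ^ 2" "0 \<le> (\<beta>/2) * norm (w x - closest_point K (w x)) ^ 2"
        using \<open>0 < \<beta>\<close> by simp_all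
      moreover have "0 \<le> g x"
        by (simp add: g_def norm1_nonneg)
      moreover have "(c - transpose A *v yk) \<bullet> x = c \<bullet> x - yk \<bullet> (A *v x)"
        by (simp only: inner_diff_left inner_transpose_mult)
      ultimately show ?thesis
        unfolding f_def inner_diff_right by linarith
    qed
  qed (rule \<open>0 < a\<close>)
  then obtain x where "\<forall>y. (f x + g x) + a * norm (x - xk) ^ 2 \<le> (f y + g y) + a * norm (y - xk) ^ 2"
    by (rule exE)
  then have x: "(f x + a * norm (x - xk) ^ 2) + g x \<le> (f y + a * norm (y - xk) ^ 2) + g y" for y
    by (simp add: ac_simps)
  \<comment> \<open>This \<open>y\<close> makes the second component of \<open>F_map\<close> vanish;
    with it, \<open>d\<close> is the gradient at \<open>x\<close> of \<open>f\<close> plus the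
    proximal term.\<close>
  define y where "y = yk - \<beta> *\<^sub>R (A *v x - b)"
  define q where "q = closest_point K (w x)"
  define d where "d = r_map c Q A K \<beta> (\<beta> / \<tau>) xk zk x y"
  define C where "C h = (1/2) * (h \<bullet> (Q *v h)) + (\<beta>/2) * norm (A *v h) ^ 2 + (\<beta>/2) * norm h ^ 2
    + a * norm h ^ 2" for h
  have mult: "multiplier_update K \<beta> zk x = \<beta> *\<^sub>R (w x - q)"
    using \<open>0 < \<beta>\<close> by (simp add: multiplier_update_def w_def q_def algebra_simps)
  have dh: "d \<bullet> h = c \<bullet> h + (Q *v x) \<bullet> h - yk \<bullet> (A *v h) + \<beta> * ((A *v x - b) \<bullet> (A *v h))
      + \<beta> * ((w x - q) \<bullet> h) + 2 * a * ((x - xk) \<bullet> h)" for h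
    unfolding d_def r_map_def mult y_def a_def inner_add_left inner_diff_left[of _ _ h]
      inner_transpose_mult inner_diff_left[of yk] inner_scaleR_left
    by simp
  have sym: "x \<bullet> (Q *v h) = (Q *v x) \<bullet> h" for h
    using Q unfolding pos_semidef_def by (metis inner_transpose_mult)
  have "g x - d \<bullet> (v - x) \<le> g v" for v
  proof (rule minimizer_subgradient[where f = "\<lambda>y. f y + a * norm (y - xk) ^ 2" and C = C])
    show "f x + a * norm (x - xk) ^ 2 + g x \<le> f y + a * norm (y - xk) ^ 2 + g y" for y
      by (rule x)
    show "convex_on UNIV g"
      unfolding g_def by (rule convex_on_norm1_matrix)
    show "f (x + t *\<^sub>R h) + a * norm (x + t *\<^sub>R h - xk) ^ 2
        \<le> f x + a * norm (x - xk) ^ 2 + t * (d \<bullet> h) + t\<^sup>2 * C h" for h t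
    proof -
      have Ah: "A *v (x + t *\<^sub>R h) = A *v x + t *\<^sub>R (A *v h)"
        by (simp add: matrix_vector_right_distrib matrix_vector_mult_scaleR)
      have e1: "(x + t *\<^sub>R h) \<bullet> (Q *v (x + t *\<^sub>R h))
          = x \<bullet> (Q *v x) + 2 * t * ((Q *v x) \<bullet> h) + t\<^sup>2 * (h \<bullet> (Q *v h))"
        by (simp add: matrix_vector_right_distrib matrix_vector_mult_scaleR inner_add_left
            inner_add_right sym inner_commute[of h "Q *v x"] power2_eq_square algebra_simps)
      have e2: "norm (A *v x + t *\<^sub>R (A *v h) - b) ^ 2
          = norm (A *v x - b) ^ 2 + 2 * t * ((A *v x - b) \<bullet> (A *v h)) + t\<^sup>2 * norm (A *v h) ^ 2"
        using norm_add_scaleR_sq[of "A *v x - b" t "A *v h"] by (simp add: algebra_simps)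
      have e3: "norm (x + t *\<^sub>R h - xk) ^ 2
          = norm (x - xk) ^ 2 + 2 * t * ((x - xk) \<bullet> h) + t\<^sup>2 * norm h ^ 2"
        using norm_add_scaleR_sq[of "x - xk" t h] by (simp add: algebra_simps)
      \<comment> \<open>The old projection \<open>q\<close> remains a competitor at the moved point,
        so the squared distance to \<open>K\<close> lies below a quadratic in \<open>t\<close> that
        agrees with it at \<open>t = 0\<close>.\<close>
      have "norm (w (x + t *\<^sub>R h) - closest_point K (w (x + t *\<^sub>R h))) ^ 2
          \<le> norm (w x - q) ^ 2 + 2 * t * ((w x - q) \<bullet> h) + t\<^sup>2 * norm h ^ 2"
      proof -
        have "q \<in> K"
          unfolding q_def using K by (intro closest_point_in_set) auto
        then have "norm (w (x + t *\<^sub>R h) - closest_point K (w (x + t *\<^sub>R h)))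
            \<le> norm (w (x + t *\<^sub>R h) - q)"
          using closest_point_le[OF K(1)] by (simp add: dist_norm)
        then have "norm (w (x + t *\<^sub>R h) - closest_point K (w (x + t *\<^sub>R h))) ^ 2
            \<le> norm (w (x + t *\<^sub>R h) - q) ^ 2"
          by (intro power_mono) auto
        also have "w (x + t *\<^sub>R h) - q = (w x - q) + t *\<^sub>R h"
          by (simp add: w_def)
        finally show ?thesis
          by (simp only: norm_add_scaleR_sq)
      qed
      then have "(\<beta>/2) * norm (w (x + t *\<^sub>R h) - closest_point K (w (x + t *\<^sub>R h))) ^ 2
          \<le> (\<beta>/2) * (norm (w x - q) ^ 2 + 2 * t * ((w x - q) \<bullet> h) + t\<^sup>2 * norm h ^ 2)"
        using \<open>0 < \<beta>\<close> by (intro mult_left_mono) auto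
      then show ?thesis
        unfolding f_def e1 e3 Ah e2 dh C_def q_def[symmetric]
        by (simp add: inner_add_right inner_diff_right[of yk] algebra_simps)
    qed
  qed
  then have "- d \<in> subdifferential (g_fun D) x"
    unfolding subdifferential_g_fun_iff g_def by simp
  then have "0 \<in> F_map c Q A b D K \<beta> (\<beta> / \<tau>) xk yk zk x y"
    using \<open>0 < \<beta>\<close> by (auto simp: F_map_def zero_prod_def d_def y_def intro!: image_eqI[of _ _ "- d"])
  then show ?thesis by blast
qed

text \<open>The resolvent with step \<open>t\<close> is the exact subproblem for
  \<open>\<beta> = t\<close> and \<open>\<tau> = 1\<close>, where the weight is the
  identity.\<close>

lemma maximal_monotone_T_ell:
  assumes "pos_semidef Q" "closed K" "convex K" "K \<noteq> {}"
  shows "maximal_monotone (T_ell c Q A b D K)"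
proof
  show "0 \<le> (u - v) \<bullet> (p - q)"
    if "u \<in> T_ell c Q A b D K p" "v \<in> T_ell c Q A b D K q" for u v p q
    using T_ell_monotone assms that by blast
  show "\<exists>q. (1 / t) *\<^sub>R (p - q) \<in> T_ell c Q A b D K q" if "0 < t" for t p
  proof -
    obtain xk yk zk where p: "p = (xk, yk, zk)" by (cases p)
    have "\<exists>x y. 0 \<in> F_map c Q A b D K t (t / 1) xk yk zk x y"
      using assms \<open>0 < t\<close> by (intro F_map_zero_exists) auto
    then obtain x y where "(0, 0) \<in> F_map c Q A b D K t (t / 1) xk yk zk x y"
      by (auto simp: zero_prod_def)
    from F_map_imp_T_ell[OF assms(2-4) \<open>0 < t\<close> _ this refl] show ?thesis
      by (auto simp: p R_op_1 zero_prod_def[symmetric])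
  qed
qed

theorem theorem2p3:
  fixes c :: "real^'n" and Q D :: "real^'n^'n" and A :: "real^'n^'m" and b :: "real^'m"
    and al au :: "ereal^'n" and K :: "(real^'n) set"
    and \<tau> \<beta> \<epsilon> \<delta> \<delta>' :: "nat \<Rightarrow> real" and \<tau>_lim r \<kappa> :: real and \<beta>_lim :: ereal
    and x z :: "nat \<Rightarrow> real^'n" and y :: "nat \<Rightarrow> real^'m"
  assumes dims: "CARD('m) \<le> CARD('n)"
    and Q: "pos_semidef Q"
    and D: "diagonal D" "pos_semidef D"
    and bounds: "\<forall>i. al $ i \<le> au $ i"
    and K: "K = box_set al au"
    and feasible: "primal_feasible c Q A b D K" "dual_feasible c Q A b D K"
    and \<tau>: "\<forall>k. \<tau> k > 0" "decseq \<tau>" "\<tau> \<longlonglongrightarrow> \<tau>_lim" "\<tau>_lim > 0"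
    and \<beta>: "\<beta> 0 > 0" "incseq \<beta>" "(\<lambda>k. ereal (\<beta> k)) \<longlonglongrightarrow> \<beta>_lim"
    and \<epsilon>: "\<forall>k. \<epsilon> k > 0" "\<epsilon> \<longlonglongrightarrow> 0"
    and \<delta>: "\<forall>k. \<delta> k \<ge> 0" "summable \<delta>"
    and r: "r > (\<Sum>k. \<delta> k)"
    and \<kappa>: "\<kappa> > 0"
      "\<forall>p. dist_set p (T_ell_zeros c Q A b D K) \<le> ereal r \<longrightarrow>
         dist_set p (T_ell_zeros c Q A b D K) \<le> ereal \<kappa> * dist_set 0 (T_ell c Q A b D K p)"
    and iterates: "pd_pmm_iterates c Q A b D K \<tau> \<beta> \<epsilon> x y z"
    and start: "dist_wrt (R_op (\<tau> 0)) (x 0, y 0, z 0) (T_ell_zeros c Q A b D K)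
      \<le> ereal (r - (\<Sum>k. \<delta> k))"
    and \<delta>': "\<forall>k. 0 \<le> \<delta>' k \<and> \<delta>' k < 1" "summable \<delta>'"
    and tolerances: "\<forall>k. \<epsilon> k \<le> min (sqrt (\<tau> k)) 1 / \<beta> k *
      min (\<delta> k) (\<delta>' k * norm_wrt (R_op (\<tau> k))
        ((x (Suc k), y (Suc k), z (Suc k)) - (x k, y k, z k)))"
  shows "(\<forall>k. dist_wrt (R_op (\<tau> (Suc k))) (x (Suc k), y (Suc k), z (Suc k)) (T_ell_zeros c Q A b D K)
           \<le> ereal (\<mu>_rate \<kappa> (\<tau> k) (\<beta> k) (\<delta>' k)) *
             dist_wrt (R_op (\<tau> k)) (x k, y k, z k) (T_ell_zeros c Q A b D K))
       \<and> (\<lambda>k. \<mu>_rate \<kappa> (\<tau> k) (\<beta> k) (\<delta>' k)) \<longlonglongrightarrow> \<mu>_limit \<kappa> \<tau>_lim \<beta>_lim"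
proof -
  define S where "S = T_ell_zeros c Q A b D K"
  have "K \<noteq> {}"
    using feasible(1) by (auto simp: primal_feasible_def primal_objective_def indicator_fun_def g_fun_def)
  have cK: "closed K" "convex K"
    unfolding K by (rule closed_box_set, rule convex_box_set)
  interpret maximal_monotone "T_ell c Q A b D K"
    using Q cK \<open>K \<noteq> {}\<close> by (rule maximal_monotone_T_ell)
  have zS: "zeros = S"
    by (simp add: zeros_def S_def T_ell_zeros_def)
  \<comment> \<open>\<open>dist_wrt\<close> to the empty set is infinity, whereas the starting point
    has a finite bound.\<close>
  have "S \<noteq> {}"
    using start by (auto simp: S_def[symmetric] dist_wrt_def top_ereal_def)
  have \<beta>pos: "0 < \<beta> k" for k
    using \<beta>(1) incseqD[OF \<beta>(2), of 0 k] by simp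
  have \<tau>pos: "0 < \<tau> k" for k
    using \<tau>(1) by simp
  have "0 < r"
    using r suminf_nonneg[OF \<delta>(2)] \<delta>(1) by fastforce

  define p where "p k = (x k, y k, z k)" for k
  define L :: "nat \<Rightarrow> (real^'n) \<times> (real^'m) \<times> (real^'n) \<Rightarrow> _" where "L k = R_op (sqrt (\<tau> k))" for k
  define d where "d k q = infdist (L k q) (L k ` S)" for k q
  have lin: "linear (L k)" for k
    unfolding L_def by (rule linear_R_op)
  have inner_L: "q \<bullet> R_op (\<tau> k) q' = L k q \<bullet> L k q'" for k q q'
    unfolding L_def using \<tau>pos by (intro inner_R_op) (simp add: less_imp_le)
  have norm_L: "norm_wrt (R_op (\<tau> k)) q = norm (L k q)" for k and q :: "(real^'n) \<times> (real^'m) \<times> (real^'n)"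
    unfolding L_def using \<tau>pos by (intro norm_wrt_R_op) (simp add: less_imp_le)
  have dist: "dist_wrt (R_op (\<tau> k)) q S = ereal (d k q)" for k q
    unfolding d_def by (rule dist_wrt_eq_infdist[OF lin norm_L \<open>S \<noteq> {}\<close>])
  have Ldist: "dist (L k a) (L k b) = norm (L k (a - b))" for k a b
    using lin by (simp add: dist_norm linear_diff)
  have eb: "infdist q S \<le> \<kappa> * norm v" if "infdist q S \<le> r" "v \<in> T_ell c Q A b D K q" for q v
  proof -
    have "dist_set q S \<le> ereal \<kappa> * dist_set 0 (T_ell c Q A b D K q)"
      using \<kappa>(2)[rule_format, of q] that(1) \<open>S \<noteq> {}\<close>
      unfolding S_def[symmetric] by (simp add: dist_set_eq_infdist)
    also have "\<dots> \<le> ereal \<kappa> * ereal (norm v)"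
    proof (rule ereal_mult_left_mono)
      show "dist_set 0 (T_ell c Q A b D K q) \<le> ereal (norm v)"
        unfolding dist_wrt_def norm_wrt_id using that(2) by (intro INF_lower2[of v]) auto
    qed (use \<kappa>(1) in simp)
    finally show ?thesis
      using \<open>S \<noteq> {}\<close> by (simp add: dist_set_eq_infdist)
  qed

  \<comment> \<open>Contraction factor of the exact step.\<close>
  define \<alpha> where "\<alpha> k = \<kappa> * \<gamma>_of (\<tau> k) / sqrt ((\<beta> k)\<^sup>2 + \<kappa>\<^sup>2 * (\<gamma>_of (\<tau> k))\<^sup>2)" for k
  \<comment> \<open>The additive bound keeps the iterates within \<open>r\<close>, where the
    contraction is available; the multiplicative one is the claimed rate.\<close>
  have step: "d (Suc k) (p (Suc k)) \<le> d k (p k) + \<delta> k \<and>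
      d (Suc k) (p (Suc k)) \<le> \<mu>_rate \<kappa> (\<tau> k) (\<beta> k) (\<delta>' k) * d k (p k)"
    if near: "d k (p k) \<le> r" for k
  proof -
    define g where "g = sqrt (\<gamma>_of (\<tau> k))"
    define m where "m = min (sqrt (\<tau> k)) 1"
    have "1 \<le> \<gamma>_of (\<tau> k)"
      by (simp add: \<gamma>_of_def)
    then have g: "g\<^sup>2 = \<gamma>_of (\<tau> k)" "1 \<le> g"
      by (simp_all add: g_def)
    have "0 < m"
      using \<tau>pos[of k] by (simp add: m_def)
    have "\<exists>x' y'. 0 \<in> F_map c Q A b D K (\<beta> k) (\<beta> k / \<tau> k) (x k) (y k) (z k) x' y'"
      using Q cK \<open>K \<noteq> {}\<close> \<beta>pos \<tau>pos by (intro F_map_zero_exists) auto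
    then obtain x' y' where
      "(0, 0) \<in> F_map c Q A b D K (\<beta> k) (\<beta> k / \<tau> k) (x k) (y k) (z k) x' y'"
      by (auto simp: zero_prod_def)
    from F_map_imp_T_ell[OF cK \<open>K \<noteq> {}\<close> \<beta>pos \<tau>pos this refl]
    obtain P where P: "(1 / \<beta> k) *\<^sub>R R_op (\<tau> k) (p k - P) \<in> T_ell c Q A b D K P"
      by (auto simp: p_def zero_prod_def[symmetric])
    have gL: "norm (L k q) \<le> g * norm q" "norm (R_op (\<tau> k) q) \<le> g * norm (L k q)" for q
      unfolding L_def g_def using \<tau>pos[of k] by (auto intro: norm_R_op_upper less_imp_le)
    have contr: "d k P \<le> \<alpha> k * d k (p k)" "d k P \<le> d k (p k)" "norm (L k (p k - P)) \<le> d k (p k)"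
      using weighted_resolvent_contraction[unfolded zS, OF lin inner_L \<beta>pos gL g(2) P
          \<open>S \<noteq> {}\<close> \<open>0 < r\<close> \<kappa>(1) eb near[unfolded d_def]]
      unfolding d_def \<alpha>_def g(1) by blast+
    \<comment> \<open>The tolerance bounds an infimum, so a residual is chosen with slack
      \<open>\<eta> * m / \<beta> k\<close>, which contributes exactly
      \<open>\<eta>\<close>.\<close>
    have "norm (L k (p (Suc k) - P)) \<le> \<beta> k * \<epsilon> k / m"
    proof (rule field_le_epsilon)
      fix \<eta> :: real assume "0 < \<eta>"
      have "dist_set 0 (F_map c Q A b D K (\<beta> k) (\<beta> k / \<tau> k) (x k) (y k) (z k) (x (Suc k)) (y (Suc k)))
          \<le> ereal (\<epsilon> k)"
        using iterates by (simp add: pd_pmm_iterates_def)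
      also have "\<dots> < ereal (\<epsilon> k + \<eta> * m / \<beta> k)"
        using \<open>0 < \<eta>\<close> \<open>0 < m\<close> \<beta>pos[of k] by simp
      finally obtain u v where uv:
        "(u, v) \<in> F_map c Q A b D K (\<beta> k) (\<beta> k / \<tau> k) (x k) (y k) (z k) (x (Suc k)) (y (Suc k))"
        "norm (u, v) < \<epsilon> k + \<eta> * m / \<beta> k"
        unfolding dist_wrt_def norm_wrt_id INF_less_iff by auto
      have zk: "z (Suc k) = multiplier_update K (\<beta> k) (z k) (x (Suc k))"
        using iterates by (simp add: pd_pmm_iterates_def)
      have "norm (L k (p (Suc k) - P)) \<le> \<beta> k * norm (u, v, 0 :: real^'n) / m"
        using F_map_imp_T_ell[OF cK \<open>K \<noteq> {}\<close> \<beta>pos \<tau>pos uv(1) zk]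
        by (intro inexact_resolvent_dist[OF lin inner_L \<beta>pos _ \<open>0 < m\<close> P])
          (simp_all add: p_def L_def m_def norm_R_op_lower[OF \<tau>pos])
      also have "norm (u, v, 0 :: real^'n) = norm (u, v)"
        by (simp add: norm_Pair)
      also have "\<beta> k * norm (u, v) / m \<le> \<beta> k * (\<epsilon> k + \<eta> * m / \<beta> k) / m"
        using uv(2) \<beta>pos[of k] \<open>0 < m\<close> by (intro divide_right_mono mult_left_mono) auto
      also have "\<dots> = \<beta> k * \<epsilon> k / m + \<eta>"
        using \<beta>pos[of k] \<open>0 < m\<close> by (simp add: field_simps)
      finally show "norm (L k (p (Suc k) - P)) \<le> \<beta> k * \<epsilon> k / m + \<eta>" .
    qed
    \<comment> \<open>The factor \<open>m / \<beta> k\<close> in the tolerances cancels the loss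
      \<open>\<beta> k / m\<close>.\<close>
    also have "\<dots> \<le> \<beta> k * (m / \<beta> k * min (\<delta> k) (\<delta>' k * norm (L k (p (Suc k) - p k)))) / m"
      using tolerances[rule_format, of k] \<beta>pos[of k] \<open>0 < m\<close>
      unfolding norm_L p_def[symmetric] m_def[symmetric]
      by (intro divide_right_mono mult_left_mono) auto
    also have "\<dots> = min (\<delta> k) (\<delta>' k * norm (L k (p (Suc k) - p k)))"
      using \<beta>pos[of k] \<open>0 < m\<close> by simp
    finally have err: "norm (L k (p (Suc k) - P)) \<le> \<delta> k"
      "norm (L k (p (Suc k) - P)) \<le> \<delta>' k * norm (L k (p (Suc k) - p k))"
      by simp_all
    \<comment> \<open>As \<open>\<tau>\<close> does not increase, passing to the next weight can
      only shorten distances.\<close>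
    have "d (Suc k) (p (Suc k)) \<le> d k (p (Suc k))"
      unfolding d_def[of k]
    proof (rule le_infdist)
      fix w assume "w \<in> L k ` S"
      then obtain s where s: "s \<in> S" "w = L k s" by auto
      have "d (Suc k) (p (Suc k)) \<le> norm (L (Suc k) (p (Suc k) - s))"
        unfolding d_def Ldist[symmetric] using s(1) by (intro infdist_le) auto
      also have "\<dots> \<le> norm (L k (p (Suc k) - s))"
        unfolding L_def using decseqD[OF \<tau>(2), of k "Suc k"] less_imp_le[OF \<tau>pos]
        by (intro norm_R_op_mono) simp
      finally show "d (Suc k) (p (Suc k)) \<le> dist (L k (p (Suc k))) w"
        by (simp add: s(2) Ldist)
    qed (use \<open>S \<noteq> {}\<close> in simp)
    also have "\<dots> \<le> d k P + norm (L k (p (Suc k) - P))"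
      unfolding d_def Ldist[symmetric] by (rule infdist_triangle)
    finally have main: "d (Suc k) (p (Suc k)) \<le> d k P + norm (L k (p (Suc k) - P))" .
    define t where "t = \<delta>' k"
    define n where "n = norm (L k (p (Suc k) - p k))"
    have t: "0 \<le> t" "t < 1"
      using \<delta>'(1) by (auto simp: t_def)
    have "L k (p (Suc k) - p k) = L k (p (Suc k) - P) - L k (p k - P)"
      using lin by (simp add: linear_diff)
    \<comment> \<open>The relative criterion has the step length \<open>n\<close> on both sides;
      absorbing it costs the factor \<open>1 - t\<close>.\<close>
    then have "n \<le> t * n + d k (p k)"
      using norm_triangle_ineq4[of "L k (p (Suc k) - P)" "L k (p k - P)"] err(2) contr(3)
      by (simp add: n_def t_def)
    then have "(1 - t) * n \<le> d k (p k)"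
      by (simp add: algebra_simps)
    have d0: "0 \<le> d k (p k)"
      by (simp add: d_def infdist_nonneg)
    have "0 \<le> n"
      by (simp add: n_def)
    have "0 \<le> \<alpha> k"
      using \<kappa>(1) \<open>1 \<le> \<gamma>_of (\<tau> k)\<close> by (simp add: \<alpha>_def)
    have "(1 - t) * d (Suc k) (p (Suc k)) \<le> (1 - t) * (\<alpha> k * d k (p k) + t * n)"
      using main contr(1) err(2) t by (intro mult_left_mono) (auto simp: t_def n_def)
    also have "\<dots> = (1 - t) * (\<alpha> k * d k (p k)) + t * ((1 - t) * n)"
      by (simp add: algebra_simps)
    \<comment> \<open>Enlarging \<open>1 - t\<close> to \<open>1 + t\<close> gives the form of
      \<open>\<mu>_rate\<close>.\<close>
    also have "\<dots> \<le> (1 + t) * (\<alpha> k * d k (p k)) + t * d k (p k)"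
      using t d0 \<open>0 \<le> n\<close> \<open>0 \<le> \<alpha> k\<close> \<open>(1 - t) * n \<le> d k (p k)\<close> by (intro add_mono mult_mono) auto
    also have "\<dots> = (t + (1 + t) * \<alpha> k) * d k (p k)"
      by (simp add: algebra_simps)
    finally have "d (Suc k) (p (Suc k)) \<le> \<mu>_rate \<kappa> (\<tau> k) (\<beta> k) (\<delta>' k) * d k (p k)"
      using t unfolding \<mu>_rate_def \<alpha>_def[symmetric] t_def[symmetric] by (simp add: field_simps)
    moreover have "d (Suc k) (p (Suc k)) \<le> d k (p k) + \<delta> k"
      using main contr(2) err(1) by linarith
    ultimately show ?thesis by blast
  qed

  have partial: "(\<Sum>j<k. \<delta> j) \<le> (\<Sum>j. \<delta> j)" for k
    using \<delta> by (intro sum_le_suminf) auto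
  \<comment> \<open>Each step adds at most \<open>\<delta> k\<close>, and the margin of the starting
    point leaves room for all of these errors.\<close>
  have near: "d k (p k) \<le> r - (\<Sum>j. \<delta> j) + (\<Sum>j<k. \<delta> j)" for k
  proof (induction k)
    case 0
    then show ?case
      using start by (simp add: S_def[symmetric] p_def[symmetric] dist)
  next
    case (Suc k)
    then have "d k (p k) \<le> r"
      using partial[of k] by linarith
    then show ?case
      using step[of k] Suc by simp
  qed
  have "d (Suc k) (p (Suc k)) \<le> \<mu>_rate \<kappa> (\<tau> k) (\<beta> k) (\<delta>' k) * d k (p k)" for k
  proof -
    have "d k (p k) \<le> r"
      using near[of k] partial[of k] by linarith
    then show ?thesis
      using step by blast
  qed
  then have rate: "\<forall>k. dist_wrt (R_op (\<tau> (Suc k))) (x (Suc k), y (Suc k), z (Suc k)) S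
      \<le> ereal (\<mu>_rate \<kappa> (\<tau> k) (\<beta> k) (\<delta>' k)) * dist_wrt (R_op (\<tau> k)) (x k, y k, z k) S"
    by (simp add: dist p_def[symmetric])

  have \<delta>'0: "\<delta>' \<longlonglongrightarrow> 0"
    using \<delta>'(2) by (rule summable_LIMSEQ_zero)
  have \<gamma>: "(\<lambda>k. \<gamma>_of (\<tau> k)) \<longlonglongrightarrow> \<gamma>_of \<tau>_lim"
    unfolding \<gamma>_of_def by (intro tendsto_intros \<tau>(3))
  have "\<alpha> \<longlonglongrightarrow> \<mu>_limit \<kappa> \<tau>_lim \<beta>_lim"
  proof (cases \<beta>_lim)
    case (real B)
    then have B: "\<beta> \<longlonglongrightarrow> B"
      using \<beta>(3) by simp
    then have "\<beta> 0 \<le> B"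
      using \<beta>(2) by (intro incseq_le)
    then have "0 < B\<^sup>2 + \<kappa>\<^sup>2 * (\<gamma>_of \<tau>_lim)\<^sup>2"
      using \<beta>(1) by (simp add: add_pos_nonneg)
    then have "\<alpha> \<longlonglongrightarrow> \<kappa> * \<gamma>_of \<tau>_lim / sqrt (B\<^sup>2 + \<kappa>\<^sup>2 * (\<gamma>_of \<tau>_lim)\<^sup>2)"
      unfolding \<alpha>_def by (intro tendsto_intros B \<gamma>) auto
    then show ?thesis
      by (simp add: \<mu>_limit_def real)
  next
    case PInf
    then have \<beta>top: "filterlim \<beta> at_top sequentially"
      using \<beta>(3) by (simp add: tendsto_PInfty_eq_at_top)
    \<comment> \<open>This quotient dominates \<open>\<alpha> k\<close>, because the square root is
      at least \<open>\<beta> k\<close>.\<close>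
    have "(\<lambda>k. \<kappa> * \<gamma>_of (\<tau> k) / \<beta> k) \<longlonglongrightarrow> 0"
      by (rule real_tendsto_divide_at_top[OF tendsto_mult[OF tendsto_const \<gamma>] \<beta>top])
    then have "\<alpha> \<longlonglongrightarrow> 0"
    proof (rule Lim_null_comparison[rotated])
      show "\<forall>\<^sub>F k in sequentially. norm (\<alpha> k) \<le> \<kappa> * \<gamma>_of (\<tau> k) / \<beta> k"
      proof (intro always_eventually allI)
        fix k
        have "\<beta> k \<le> sqrt ((\<beta> k)\<^sup>2 + \<kappa>\<^sup>2 * (\<gamma>_of (\<tau> k))\<^sup>2)"
          by (intro real_le_rsqrt) simp
        moreover have "0 \<le> \<kappa> * \<gamma>_of (\<tau> k)"
          using \<kappa>(1) by (simp add: \<gamma>_of_def)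
        ultimately show "norm (\<alpha> k) \<le> \<kappa> * \<gamma>_of (\<tau> k) / \<beta> k"
          using \<beta>pos[of k] by (simp add: \<alpha>_def abs_mult frac_le)
      qed
    qed
    then show ?thesis
      by (simp add: \<mu>_limit_def PInf)
  next
    case MInf
    \<comment> \<open>A nondecreasing sequence stays above \<open>\<beta> 0\<close>, so its limit
      cannot be minus infinity.\<close>
    have "ereal (\<beta> 0) \<le> \<beta>_lim"
      by (rule LIMSEQ_le_const[OF \<beta>(3)]) (use incseqD[OF \<beta>(2)] in auto)
    then show ?thesis
      using MInf by simp
  qed
  then have "(\<lambda>k. inverse (1 - \<delta>' k) * (\<delta>' k + (1 + \<delta>' k) * \<alpha> k))
      \<longlonglongrightarrow> inverse (1 - 0) * (0 + (1 + 0) * \<mu>_limit \<kappa> \<tau>_lim \<beta>_lim)"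
    by (intro tendsto_intros \<delta>'0) auto
  then have "(\<lambda>k. \<mu>_rate \<kappa> (\<tau> k) (\<beta> k) (\<delta>' k)) \<longlonglongrightarrow> \<mu>_limit \<kappa> \<tau>_lim \<beta>_lim"
    by (simp add: \<mu>_rate_def \<alpha>_def)
  with rate show ?thesis
    by (simp add: S_def)
qed

end
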